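(* Let $1\le k<n$ be integers and let $s\in[0,1]$. Let $E\subset A(n,k)$ be a nonempty family of $k$-dimensional affine subspaces of $\mathbb{R}^n$ with $\dim E=s$, and let $B$ be a subset of $\bigcup_{P\in E}P$ such that $\dim(B\cap P)=k$ for every $P\in E$. Then $$\dim B=\dim\left(\bigcup_{P\in E}P\right)=s+k.$$
   Context: $\dim$ denotes Hausdorff dimension. $A(n,k)$ denotes the space of all $k$-dimensional affine subspaces of $\mathbb{R}^n$. The Hausdorff dimension of a subset $E\subset A(n,k)$ is taken with respect to any natural metric $\rho$ on $A(n,k)$. Here $\rho$ is natural if it is strongly equivalent to the following metric $d$: write $P=V+a$, $P'=V'+a'$ with $V,V'$ $k$-dimensional linear subspaces, $a\in V^\perp$, $a'\in V'^\perp$, and put $d(P,P')=\|\pi_V-\pi_{V'}\|+|a-a'|$, where $\pi_V$ is the orthogonal projection onto $V$ and $\|\cdot\|$ is the operator norm; strongly equivalent means that there are constants $K_1,K_2>0$ with $K_1 d(P,P')\le\rho(P,P')\le K_2 d(P,P')$ for all $P,P'\in A(n,k)$. No measurability of $E$ or $B$ is assumed. *)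

theory Defs
  imports "HOL-Analysis.Analysis"
begin

section \<open>Hausdorff dimension of a subset of a metric space\<close>

definition ediam :: "'a metric \<Rightarrow> 'a set \<Rightarrow> ennreal" where
  "ediam m U = (SUP x\<in>U. SUP y\<in>U. ennreal (mdist m x y))"

text \<open>
  The power of the diameter, with the usual conventions that the empty set contributes 0 and
  that \<open>0\<^sup>0 = 1\<close> (whereas \<open>0 powr 0 = 0\<close>), so that the 0-dimensional measure counts points.
  It is only used for sets of finite diameter.
\<close>

definition diam_pow :: "'a metric \<Rightarrow> real \<Rightarrow> 'a set \<Rightarrow> ennreal" where
  "diam_pow m t U =
     (if U = {} then 0 else if t = 0 then 1 else ennreal (enn2real (ediam m U) powr t))"

definition hausdorff_premeasure :: "'a metric \<Rightarrow> real \<Rightarrow> real \<Rightarrow> 'a set \<Rightarrow> ennreal" where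
  "hausdorff_premeasure m t \<delta> A =
     (INF U \<in> {U :: nat \<Rightarrow> 'a set. A \<subseteq> (\<Union>i. U i) \<and>
                 (\<forall>i. U i \<subseteq> mspace m \<and> ediam m (U i) \<le> ennreal \<delta>)}.
        \<Sum>i. diam_pow m t (U i))"

definition hausdorff_measure :: "'a metric \<Rightarrow> real \<Rightarrow> 'a set \<Rightarrow> ennreal" where
  "hausdorff_measure m t A = (SUP \<delta>\<in>{0<..}. hausdorff_premeasure m t \<delta> A)"

text \<open>Intended for \<open>A \<subseteq> mspace m\<close>. The value is \<open>\<infinity>\<close> if no measure vanishes; the empty set gets 0.\<close>

definition hausdorff_dim :: "'a metric \<Rightarrow> 'a set \<Rightarrow> ennreal" where
  "hausdorff_dim m A = (INF t \<in> {t. 0 \<le> t \<and> hausdorff_measure m t A = 0}. ennreal t)"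


section \<open>The space of affine subspaces and its natural metrics\<close>

definition affine_subspaces :: "nat \<Rightarrow> (real ^ 'n) set set" where
  "affine_subspaces k = {P. affine P \<and> aff_dim P = int k}"

definition orth_proj :: "(real ^ 'n) set \<Rightarrow> real ^ 'n \<Rightarrow> real ^ 'n" where
  "orth_proj V x = (THE y. y \<in> V \<and> x - y \<in> V\<^sup>\<bottom>)"

lemma orth_proj_ex1:
  fixes V :: "(real ^ 'n) set"
  assumes "subspace V"
  shows "\<exists>!y. y \<in> V \<and> x - y \<in> V\<^sup>\<bottom>"
proof -
  obtain y z where yz: "y \<in> span V" "\<And>w. w \<in> span V \<Longrightarrow> orthogonal z w" "x = y + z"
    using orthogonal_subspace_decomp_exists by blast
  have "y \<in> V" "x - y \<in> V\<^sup>\<bottom>"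
    using yz assms by (auto simp: orthogonal_comp_def orthogonal_commute span_eq_iff[THEN iffD2])
  moreover have "u = v" if "u \<in> V" "x - u \<in> V\<^sup>\<bottom>" "v \<in> V" "x - v \<in> V\<^sup>\<bottom>" for u v
  proof -
    have 1: "u - v \<in> V" using that assms by (simp add: subspace_diff)
    have "u - v = (x - v) - (x - u)" by simp
    hence "u - v \<in> V\<^sup>\<bottom>"
      using subspace_diff[OF subspace_orthogonal_comp that(4) that(2)] by simp
    hence "orthogonal (u - v) (u - v)" using 1 by (auto simp: orthogonal_comp_def)
    thus ?thesis by (simp add: orthogonal_def)
  qed
  ultimately show ?thesis by (intro ex1I[of _ y]) auto
qed

definition orth_form :: "(real ^ 'n) set \<Rightarrow> (real ^ 'n) set \<Rightarrow> real ^ 'n \<Rightarrow> bool" where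
  "orth_form P V a \<longleftrightarrow> subspace V \<and> a \<in> V\<^sup>\<bottom> \<and> P = (+) a ` V"

definition direction :: "(real ^ 'n) set \<Rightarrow> (real ^ 'n) set" where
  "direction P = (THE V. \<exists>a. orth_form P V a)"

definition offset :: "(real ^ 'n) set \<Rightarrow> real ^ 'n" where
  "offset P = (THE a. \<exists>V. orth_form P V a)"

lemma orth_form_exists:
  fixes P :: "(real ^ 'n) set"
  assumes "P \<in> affine_subspaces k"
  obtains V a where "orth_form P V a" "dim V = k"
proof -
  have P: "affine P" "aff_dim P = int k" "P \<noteq> {}"
    using assms by (auto simp: affine_subspaces_def)
  obtain L where L: "subspace L" "affine_parallel P L"
    using affine_parallel_subspace[OF P(1,3)] by (elim ex1E conjE)
  have "affine_parallel L P"
    using L(2) by (rule affine_parallel_commute)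
  then obtain b where b: "P = (+) b ` L"
    unfolding affine_parallel_def by (elim exE)
  obtain y where y: "y \<in> L" "b - y \<in> L\<^sup>\<bottom>"
    using orth_proj_ex1[OF L(1)] by blast
  have "(+) b ` L = (+) (b - y) ` L"
  proof (intro set_eqI iffI)
    fix z assume "z \<in> (+) b ` L"
    then obtain w where "w \<in> L" "z = b + w" by auto
    thus "z \<in> (+) (b - y) ` L"
      using y L by (intro image_eqI[of _ _ "w + y"]) (auto simp: subspace_add)
  next
    fix z assume "z \<in> (+) (b - y) ` L"
    then obtain w where "w \<in> L" "z = (b - y) + w" by auto
    thus "z \<in> (+) b ` L"
      using y L by (intro image_eqI[of _ _ "w - y"]) (auto simp: subspace_diff)
  qed
  hence "orth_form P L (b - y)" using L y b by (auto simp: orth_form_def)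
  moreover have "dim L = k" using aff_dim_affine[OF P(1) L P(3)] P(2) by simp
  ultimately show ?thesis using that by blast
qed

lemma orth_form_unique:
  fixes P :: "(real ^ 'n) set"
  assumes "orth_form P V a" "orth_form P V' a'"
  shows "V = V'" "a = a'"
proof -
  have diff: "U = {x - y | x y. x \<in> P \<and> y \<in> P}" if "orth_form P U c" for U c
  proof -
    have U: "subspace U" "P = (+) c ` U" using that by (auto simp: orth_form_def)
    have "u \<in> {x - y | x y. x \<in> P \<and> y \<in> P}" if "u \<in> U" for u
      using U that subspace_0[of U] by (intro CollectI exI[of _ "c + u"] exI[of _ "c + 0"]) auto
    moreover have "x - y \<in> U" if "x \<in> P" "y \<in> P" for x y
      using that U by (auto simp: subspace_diff)
    ultimately show ?thesis by blast
  qed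
  show V: "V = V'" using diff[OF assms(1)] diff[OF assms(2)] by simp
  have sub: "subspace V" using assms by (simp add: orth_form_def)
  have P: "c \<in> P" if "orth_form P U c" for U c
    using that subspace_0[of U] image_eqI[of c "(+) c" 0 U] by (simp add: orth_form_def)
  have "a \<in> P" "a' \<in> P"
    using P[OF assms(1)] P[OF assms(2)] .
  hence "a - a' \<in> V" using diff[OF assms(1)] by blast
  moreover have "a - a' \<in> V\<^sup>\<bottom>"
    using assms unfolding V orth_form_def by (intro subspace_diff[OF subspace_orthogonal_comp]) simp_all
  ultimately have "orthogonal (a - a') (a - a')" by (auto simp: orthogonal_comp_def)
  thus "a = a'" by (simp add: orthogonal_def)
qed

lemma direction_offset_eq:
  assumes "orth_form P V a"
  shows "direction P = V" "offset P = a"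
proof -
  show "direction P = V"
    unfolding direction_def
  proof (rule the_equality)
    show "\<exists>a. orth_form P V a" using assms by (rule exI)
    show "W = V" if "\<exists>a. orth_form P W a" for W
      using that orth_form_unique(1)[OF _ assms] by (elim exE)
  qed
  show "offset P = a"
    unfolding offset_def
  proof (rule the_equality)
    show "\<exists>V. orth_form P V a" using assms by (rule exI)
    show "b = a" if "\<exists>V. orth_form P V b" for b
      using that orth_form_unique(2)[OF _ assms] by (elim exE)
  qed
qed

definition affine_dist :: "(real ^ 'n) set \<Rightarrow> (real ^ 'n) set \<Rightarrow> real" where
  "affine_dist P P' =
     onorm (\<lambda>x. orth_proj (direction P) x - orth_proj (direction P') x)
       + norm (offset P - offset P')"

definition natural_metric :: "nat \<Rightarrow> (real ^ 'n) set metric \<Rightarrow> bool" where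
  "natural_metric k \<rho> \<longleftrightarrow>
     mspace \<rho> = affine_subspaces k \<and>
     (\<exists>K\<^sub>1>0. \<exists>K\<^sub>2>0. \<forall>P\<in>affine_subspaces k. \<forall>P'\<in>affine_subspaces k.
        K\<^sub>1 * affine_dist P P' \<le> mdist \<rho> P P' \<and> mdist \<rho> P P' \<le> K\<^sub>2 * affine_dist P P')"

end

theory Submission
  imports Defs
begin

text \<open>
  The upper bound \<open>dim (\<Union>E) \<le> s + k\<close> is a covering argument. Planes that are close in
  \<open>affine_dist\<close> are close to each other in every fixed ball, so a set of planes of diameter \<open>r\<close>
  sweeps out, in that ball, a set covered by \<open>O(r\<^sup>-\<^sup>k)\<close> pieces of diameter \<open>O(r)\<close>. A cover of \<open>E\<close>
  with small \<open>\<Sum> r\<^sup>t\<close> therefore gives a cover of \<open>\<Union>E\<close> with small \<open>\<Sum> r\<^sup>t\<^sup>+\<^sup>k\<close>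
  (\<open>hcontent_planes_le\<close>, \<open>hcontent_Union_zero\<close>).

  The lower bound for \<open>dim B\<close> is an \<open>L\<^sup>2\<close> argument at a single scale. Suppose that \<open>dim B < u < s + k\<close>
  and replace \<open>s\<close> by a slightly smaller exponent, again called \<open>s\<close>. Then \<open>B\<close> is covered by dyadic
  cells, \<open>O(2\<^sup>u\<^sup>l)\<close> of them of side \<open>2\<^sup>-\<^sup>l\<close> for each \<open>l \<ge> l0\<close>. Let \<open>F l\<close> consist of the planes in \<open>E\<close>
  whose slice of \<open>B\<close> meets more than \<open>2\<^sup>(\<^sup>k\<^sup>-\<^sup>2\<^sup>e\<^sup>)\<^sup>l\<close> of the cells of side \<open>2\<^sup>-\<^sup>l\<close>. Every plane is in some
  \<open>F l\<close>, because otherwise the \<open>(k-e)\<close>-dimensional content of its slice would be tiny. A discrete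
  version of Frostman's lemma (\<open>discrete_frostman\<close>) finds in \<open>F l\<close> a finite set \<open>S\<close> of planes, at most
  \<open>(2\<^sup>l r)\<^sup>s\<close> of them within \<open>O(r)\<close> of any given one, such that \<open>F l\<close> has \<open>s\<close>-dimensional content
  \<open>O(l 2\<^sup>-\<^sup>s\<^sup>l |S|)\<close>.

  Two planes at distance \<open>d\<close> have \<open>O(2\<^sup>(\<^sup>k\<^sup>-\<^sup>1\<^sup>)\<^sup>l / d)\<close> cells in common (\<open>card_common_cells_le\<close>): the
  points of one plane that are \<open>2\<^sup>-\<^sup>l\<close>-close to the other form a slab of width \<open>O(2\<^sup>-\<^sup>l / d)\<close>. As \<open>s \<le> 1\<close>,
  summing this over the planes of \<open>S\<close> gives \<open>O(l 2\<^sup>k\<^sup>l)\<close> for each fixed plane, and the Cauchy-Schwarz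
  inequality yields \<open>|S| 2\<^sup>2\<^sup>(\<^sup>k\<^sup>-\<^sup>2\<^sup>e\<^sup>)\<^sup>l \<le> O(l 2\<^sup>k\<^sup>l) 2\<^sup>u\<^sup>l\<close>. When \<open>u \<le> s + k - 8e\<close> this makes the content of
  \<open>F l\<close> at most \<open>O(2\<^sup>-\<^sup>e\<^sup>l)\<close>; summed over \<open>l \<ge> l0\<close> it shows that \<open>E\<close> has content \<open>0\<close> in dimension \<open>s\<close>,
  a contradiction (\<open>hcontent_planes_zero\<close>).

  Both halves measure sets by their Hausdorff content, which is countably subadditive on arbitrary
  sets and, in positive dimension, vanishes together with the Hausdorff measure. Constants are kept uniform by splitting
  \<open>E\<close> into countably many charts, in each of which all planes are graphs over the same \<open>k\<close>
  coordinates with bounded coefficients.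
\<close>

section \<open>Hausdorff content\<close>

definition diam_le :: "('a \<Rightarrow> 'a \<Rightarrow> real) \<Rightarrow> 'a set \<Rightarrow> real \<Rightarrow> bool" where
  "diam_le d U r \<longleftrightarrow> 0 \<le> r \<and> (\<forall>x\<in>U. \<forall>y\<in>U. d x y \<le> r)"

text \<open>
  The function \<open>d\<close> is only a parameter, so that \<open>affine_dist\<close> can be used without first making it a
  metric. The radii \<open>r i\<close> bound the diameters instead of being equal to them; the sets that pad
  a finite cover are empty sets with \<open>r i = 0\<close>, and these contribute \<open>0 powr t = 0\<close>.
\<close>

definition hcontent :: "('a \<Rightarrow> 'a \<Rightarrow> real) \<Rightarrow> real \<Rightarrow> 'a set \<Rightarrow> ennreal" where
  "hcontent d t A =
     (INF (U, r) \<in> {(U, r). A \<subseteq> (\<Union>i. U i) \<and> (\<forall>i::nat. diam_le d (U i) (r i))}.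
        \<Sum>i. ennreal (r i powr t))"

lemma diam_le_mono: "diam_le d U r \<Longrightarrow> V \<subseteq> U \<Longrightarrow> r \<le> r' \<Longrightarrow> diam_le d V r'"
  unfolding diam_le_def by force

lemma hcontent_le:
  assumes "A \<subseteq> (\<Union>i. U i)" "\<And>i::nat. diam_le d (U i) (r i)"
  shows "hcontent d t A \<le> (\<Sum>i. ennreal (r i powr t))"
  unfolding hcontent_def using assms by (intro INF_lower2[of "(U, r)"]) auto

lemma hcontent_lessE:
  assumes "hcontent d t A < c"
  obtains U r where "A \<subseteq> (\<Union>i. U i)" "\<And>i::nat. diam_le d (U i) (r i)"
    "(\<Sum>i. ennreal (r i powr t)) < c"
  using assms unfolding hcontent_def INF_less_iff by auto

lemma hcontent_mono: "A \<subseteq> A' \<Longrightarrow> hcontent d t A \<le> hcontent d t A'"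
  unfolding hcontent_def by (intro INF_superset_mono) auto

lemma hcontent_le_finite:
  assumes "finite I" "A \<subseteq> (\<Union>i\<in>I. U i)" "\<And>i. i \<in> I \<Longrightarrow> diam_le d (U i) (r i)"
  shows "hcontent d t A \<le> ennreal (\<Sum>i\<in>I. r i powr t)"
proof -
  define n where "n = card I"
  obtain f where f: "bij_betw f {..<n} I"
    using ex_bij_betw_nat_finite[OF assms(1)] by (auto simp: n_def lessThan_atLeast0)
  define V where "V i = (if i < n then U (f i) else {})" for i
  define q where "q i = (if i < n then r (f i) else 0)" for i
  have "hcontent d t A \<le> (\<Sum>i. ennreal (q i powr t))"
  proof (rule hcontent_le[where U = V])
    show "A \<subseteq> (\<Union>i. V i)"
    proof
      fix x assume "x \<in> A"
      then obtain i where i: "i \<in> I" "x \<in> U i" using assms by blast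
      then obtain j where "j < n" "f j = i" using f by (auto simp: bij_betw_def)
      hence "x \<in> V j" using i by (auto simp: V_def)
      thus "x \<in> (\<Union>i. V i)" by blast
    qed
    show "diam_le d (V i) (q i)" for i
    proof (cases "i < n")
      case True
      hence "f i \<in> I" using f by (auto simp: bij_betw_def)
      thus ?thesis using assms(3) True by (auto simp: V_def q_def)
    qed (auto simp: V_def q_def diam_le_def)
  qed
  also have "\<dots> = (\<Sum>i<n. ennreal (q i powr t))"
    by (rule suminf_finite) (auto simp: q_def)
  also have "\<dots> = ennreal (\<Sum>i<n. q i powr t)" by (simp add: sum_ennreal)
  also have "(\<Sum>i<n. q i powr t) = (\<Sum>i<n. r (f i) powr t)" by (simp add: q_def)
  also have "\<dots> = (\<Sum>i\<in>I. r i powr t)" using sum.reindex_bij_betw[OF f] .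
  finally show ?thesis .
qed

lemma hcontent_UN_le: "hcontent d t (\<Union>i::nat. A i) \<le> (\<Sum>i. hcontent d t (A i))"
proof (rule ennreal_le_epsilon)
  fix e :: real assume fin: "(\<Sum>i. hcontent d t (A i)) < top" and e: "0 < e"
  have hfin: "hcontent d t (A i) < top" for i
    by (rule ennreal_suminf_lessD[OF fin])
  have "\<exists>U r. A i \<subseteq> (\<Union>j. U j) \<and> (\<forall>j::nat. diam_le d (U j) (r j)) \<and>
      (\<Sum>j. ennreal (r j powr t)) < hcontent d t (A i) + ennreal (e * (1/2)^Suc i)" for i
  proof -
    have "hcontent d t (A i) < hcontent d t (A i) + ennreal (e * (1/2)^Suc i)"
      using hfin[of i] e by (metis ennreal_add_left_cancel_less add.right_neutral ennreal_less_zero_iff less_numeral_extra(3) less_top_ennreal infinity_ennreal_def mult_pos_pos zero_less_divide_1_iff zero_less_numeral zero_less_power)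
    from hcontent_lessE[OF this] show ?thesis by metis
  qed
  then obtain U r where U: "\<And>i. A i \<subseteq> (\<Union>j. U i j)" "\<And>i j::nat. diam_le d (U i j) (r i j)"
    "\<And>i. (\<Sum>j. ennreal (r i j powr t)) < hcontent d t (A i) + ennreal (e * (1/2)^Suc i)"
    by metis
  have "hcontent d t (\<Union>i. A i) \<le> (\<Sum>n. ennreal ((\<lambda>(i,j). r i j) (prod_decode n) powr t))"
  proof (rule hcontent_le[where U = "\<lambda>n. (\<lambda>(i,j). U i j) (prod_decode n)"])
    show "(\<Union>i. A i) \<subseteq> (\<Union>n. (\<lambda>(i,j). U i j) (prod_decode n))"
    proof
      fix x assume "x \<in> (\<Union>i. A i)"
      then obtain i j where "x \<in> U i j" using U(1) by blast
      hence "x \<in> (\<lambda>(i,j). U i j) (prod_decode (prod_encode (i,j)))" by simp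
      thus "x \<in> (\<Union>n. (\<lambda>(i,j). U i j) (prod_decode n))" by (rule UN_I[OF UNIV_I])
    qed
  qed (auto simp: U(2) split: prod.split)
  also have "\<dots> = (\<Sum>n. (\<lambda>(i,j). ennreal (r i j powr t)) (prod_decode n))"
    by (simp add: case_prod_unfold)
  also have "\<dots> = (\<Sum>i. \<Sum>j. ennreal (r i j powr t))"
    by (rule suminf_ennreal_2dimen) auto
  also have "\<dots> \<le> (\<Sum>i. hcontent d t (A i) + ennreal (e * (1/2)^Suc i))"
    using U(3) by (intro suminf_le) (auto intro: less_imp_le)
  also have "\<dots> = (\<Sum>i. hcontent d t (A i)) + (\<Sum>i. ennreal (e * (1/2)^Suc i))"
    by (rule suminf_add[symmetric]) auto
  also have "(\<Sum>i. ennreal (e * (1/2)^Suc i)) = ennreal e"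
    using sums_mult[OF power_half_series, of e] e
    by (intro suminf_ennreal_eq) auto
  finally show "hcontent d t (\<Union>i. A i) \<le> (\<Sum>i. hcontent d t (A i)) + ennreal e" .
qed

lemma hcontent_UN_zero:
  assumes "countable I" "\<And>i. i \<in> I \<Longrightarrow> hcontent d t (A i) = 0"
  shows "hcontent d t (\<Union>i\<in>I. A i) = 0"
proof (cases "I = {}")
  case True
  thus ?thesis using hcontent_le[of "{}" "\<lambda>_. {}" d "\<lambda>_. 0" t] by (simp add: diam_le_def)
next
  case False
  have "hcontent d t (\<Union>i\<in>I. A i) = hcontent d t (\<Union>n. A (from_nat_into I n))"
    using False assms(1) by (metis UN_extend_simps(10) range_from_nat_into)
  also have "\<dots> \<le> (\<Sum>n. hcontent d t (A (from_nat_into I n)))" by (rule hcontent_UN_le)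
  also have "\<dots> = 0" using assms(2) from_nat_into[OF False] by simp
  finally show ?thesis by simp
qed

text \<open>
  Radii that are rounded to powers of two, or serve as the mesh of a grid, have to be positive;
  enlarging the \<open>i\<close>-th term of the sum by \<open>e / 2\<^sup>i\<^sup>+\<^sup>2\<close> achieves this.
\<close>

lemma hcontent_zero_cover:
  assumes "hcontent d t A = 0" "t > 0" "0 < e"
  obtains U r where "A \<subseteq> (\<Union>i. U i)" "\<And>i::nat. diam_le d (U i) (r i)" "\<And>i. 0 < r i"
    "summable (\<lambda>i. r i powr t)" "(\<Sum>i. r i powr t) \<le> e"
proof -
  have "hcontent d t A < ennreal (e/2)" using assms by simp
  from hcontent_lessE[OF this] obtain U r where U: "A \<subseteq> (\<Union>i. U i)"
    "\<And>i::nat. diam_le d (U i) (r i)" "(\<Sum>i. ennreal (r i powr t)) < ennreal (e/2)" by metis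
  have sm: "summable (\<lambda>i. r i powr t)" using U(3) by (intro summable_suminf_not_top) auto
  moreover have "(\<Sum>i. ennreal (r i powr t)) = ennreal (\<Sum>i. r i powr t)"
    by (rule suminf_ennreal2) (use sm in auto)
  ultimately have "ennreal (\<Sum>i. r i powr t) < ennreal (e/2)" using U(3) by simp
  hence sum1: "(\<Sum>i. r i powr t) < e/2"
    using assms(3) by (simp add: ennreal_less_iff suminf_nonneg[OF sm])
  define p where "p i = (e/2 * (1/2)^Suc i) powr (1/t)" for i :: nat
  have p: "p i powr t = e/2 * (1/2)^Suc i" for i
    unfolding p_def powr_powr using assms by simp
  define q where "q i = max (r i) (p i)" for i
  have q0: "0 < q i" for i using assms unfolding q_def p_def by (auto simp: less_max_iff_disj)
  have r0: "0 \<le> r i" for i using U(2) by (auto simp: diam_le_def)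
  have qle: "q i powr t \<le> r i powr t + e/2 * (1/2)^Suc i" for i
  proof (cases "r i \<le> p i")
    case True
    hence "q i powr t = e/2 * (1/2)^Suc i" using p[of i] by (simp add: q_def)
    moreover have "0 \<le> r i powr t" by simp
    ultimately show ?thesis by linarith
  next
    case False
    hence "q i powr t = r i powr t" by (simp add: q_def)
    moreover have "0 \<le> e/2 * (1/2)^Suc i" using assms by simp
    ultimately show ?thesis by linarith
  qed
  have sp: "(\<lambda>i. e/2 * (1/2)^Suc i) sums (e/2)"
    using sums_mult[OF power_half_series, of "e/2"] by simp
  have s2: "summable (\<lambda>i. r i powr t + e/2 * (1/2)^Suc i)"
    by (intro summable_add sm sums_summable[OF sp])
  have s3: "summable (\<lambda>i. q i powr t)"
    by (rule summable_comparison_test'[OF s2, of 0]) (use qle in auto)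
  have "(\<Sum>i. q i powr t) \<le> (\<Sum>i. r i powr t + e/2 * (1/2)^Suc i)"
    by (intro suminf_le qle s2 s3)
  also have "\<dots> = (\<Sum>i. r i powr t) + e/2"
    using suminf_add[OF sm sums_summable[OF sp]] sums_unique[OF sp] by simp
  finally have "(\<Sum>i. q i powr t) \<le> e" using sum1 by simp
  moreover have "diam_le d (U i) (q i)" for i
    using U(2)[of i] by (rule diam_le_mono) (auto simp: q_def)
  ultimately show ?thesis by (intro that[OF U(1) _ q0 s3])
qed

text \<open>
  A cover by sets of diameter at most \<open>1\<close> becomes cheaper when the exponent grows from \<open>t'\<close> to \<open>t\<close>.
  This covers \<open>t' = 0\<close> as well, where every nonempty set counts \<open>1\<close>.
\<close>

lemma hausdorff_dim_less_imp:
  assumes "hausdorff_dim m A < ennreal t" "t > 0"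
  shows "hcontent (mdist m) t A = 0"
proof -
  obtain t' where t': "0 \<le> t'" "hausdorff_measure m t' A = 0" "ennreal t' < ennreal t"
    using assms(1) unfolding hausdorff_dim_def INF_less_iff by auto
  have tt: "t' < t" using t' assms(2) by (simp add: ennreal_less_iff)
  have pre: "hausdorff_premeasure m t' 1 A = 0"
  proof -
    have "hausdorff_premeasure m t' 1 A \<le> hausdorff_measure m t' A"
      unfolding hausdorff_measure_def by (rule SUP_upper) auto
    thus ?thesis using t'(2) by simp
  qed
  have "hcontent (mdist m) t A \<le> 0 + ennreal e" if e: "0 < e" for e
  proof -
    have "hausdorff_premeasure m t' 1 A < ennreal e" using pre e by simp
    then obtain U where U: "A \<subseteq> (\<Union>i. U i)"
      "\<And>i::nat. U i \<subseteq> mspace m \<and> ediam m (U i) \<le> ennreal 1"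
      "(\<Sum>i. diam_pow m t' (U i)) < ennreal e"
      unfolding hausdorff_premeasure_def INF_less_iff by blast
    define r where "r i = enn2real (ediam m (U i))" for i
    have er: "ediam m (U i) = ennreal (r i)" for i
      unfolding r_def using U(2)[of i] by (metis ennreal_enn2real ennreal_less_top le_less_trans)
    have r: "0 \<le> r i" "r i \<le> 1" for i
    proof -
      show "0 \<le> r i" by (simp add: r_def)
      have "ennreal (r i) \<le> ennreal 1" using U(2)[of i] unfolding er by blast
      thus "r i \<le> 1" by simp
    qed
    have "diam_le (mdist m) (U i) (r i)" for i
      unfolding diam_le_def
    proof (intro conjI ballI)
      fix x y assume xy: "x \<in> U i" "y \<in> U i"
      have "ennreal (mdist m x y) \<le> ediam m (U i)"
        unfolding ediam_def by (rule SUP_upper2[OF xy(1)], rule SUP_upper2[OF xy(2)]) simp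
      thus "mdist m x y \<le> r i" using er r by simp
    qed (use r in auto)
    with U(1) have "hcontent (mdist m) t A \<le> (\<Sum>i. ennreal (r i powr t))"
      by (rule hcontent_le)
    also have "\<dots> \<le> (\<Sum>i. diam_pow m t' (U i))"
    proof (intro suminf_le allI)
      fix i
      show "ennreal (r i powr t) \<le> diam_pow m t' (U i)"
      proof (cases "U i = {} \<or> r i = 0")
        case True
        hence "r i = 0" by (auto simp: r_def ediam_def bot_ennreal)
        thus ?thesis by simp
      next
        case False
        hence "r i powr t \<le> r i powr t'" using r[of i] tt by (intro powr_mono') auto
        moreover have "r i powr t' \<le> 1" using r[of i] t' by (simp add: powr_le1)
        ultimately show ?thesis using False by (auto simp: diam_pow_def r_def)
      qed
    qed auto
    also have "\<dots> \<le> ennreal e" using U(3) by simp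
    finally show ?thesis by simp
  qed
  hence "hcontent (mdist m) t A \<le> 0" by (rule ennreal_le_epsilon)
  thus ?thesis by simp
qed

text \<open>
  A cover whose sum is at most \<open>\<delta> powr t\<close> consists of sets of diameter at most \<open>\<delta>\<close>, so covers that
  witness zero content are admissible for the premeasures at every scale.
\<close>

lemma hausdorff_dim_le:
  assumes "hcontent (mdist m) t A = 0" "t > 0" "A \<subseteq> mspace m"
  shows "hausdorff_dim m A \<le> ennreal t"
proof -
  have "hausdorff_premeasure m t \<delta> A = 0" if d: "\<delta> > 0" for \<delta>
  proof -
    have "hausdorff_premeasure m t \<delta> A \<le> 0 + ennreal e" if e: "0 < e" for e
    proof -
      have "0 < min e (\<delta> powr t)" using e d by simp
      from hcontent_zero_cover[OF assms(1,2) this] obtain U r where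
        U: "A \<subseteq> (\<Union>i. U i)" "\<And>i::nat. diam_le (mdist m) (U i) (r i)" "\<And>i. 0 < r i"
          "summable (\<lambda>i. r i powr t)" "(\<Sum>i. r i powr t) \<le> min e (\<delta> powr t)"
        by blast
      define V where "V i = U i \<inter> mspace m" for i
      have rle: "r i \<le> \<delta>" for i
      proof (rule ccontr)
        assume "\<not> r i \<le> \<delta>"
        hence "\<delta> powr t < r i powr t" using d assms(2) by (intro powr_less_mono2) auto
        also have "r i powr t \<le> (\<Sum>i. r i powr t)"
          using sum_le_suminf[OF U(4), of "{i}"] by simp
        finally show False using U(5) by simp
      qed
      have ed: "ediam m (V i) \<le> ennreal (r i)" for i
        unfolding ediam_def using U(2)[of i]
        by (intro SUP_least ennreal_leI) (auto simp: V_def diam_le_def)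
      have "hausdorff_premeasure m t \<delta> A \<le> (\<Sum>i. diam_pow m t (V i))"
        unfolding hausdorff_premeasure_def
      proof (rule INF_lower, intro CollectI conjI allI)
        show "A \<subseteq> (\<Union>i. V i)" using U(1) assms(3) by (auto simp: V_def)
        fix i show "V i \<subseteq> mspace m" by (auto simp: V_def)
        show "ediam m (V i) \<le> ennreal \<delta>" using ed[of i] rle[of i]
          by (meson ennreal_leI order_trans)
      qed
      also have "\<dots> \<le> (\<Sum>i. ennreal (r i powr t))"
      proof (intro suminf_le allI)
        fix i
        have "enn2real (ediam m (V i)) \<le> r i"
          using ed[of i] U(3)[of i] by (intro enn2real_leI) auto
        thus "diam_pow m t (V i) \<le> ennreal (r i powr t)"
          using assms(2) by (auto simp: diam_pow_def intro!: ennreal_leI powr_mono2)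
      qed auto
      also have "\<dots> = ennreal (\<Sum>i. r i powr t)" by (rule suminf_ennreal2) (use U in auto)
      also have "\<dots> \<le> ennreal e" using U(5) by (intro ennreal_leI) auto
      finally show ?thesis by simp
    qed
    hence "hausdorff_premeasure m t \<delta> A \<le> 0" by (rule ennreal_le_epsilon)
    thus ?thesis by simp
  qed
  hence "hausdorff_measure m t A = 0" unfolding hausdorff_measure_def by simp
  thus ?thesis unfolding hausdorff_dim_def using assms(2) by (intro INF_lower2[of t]) auto
qed

lemma hausdorff_dim_mono:
  assumes "A \<subseteq> A'" shows "hausdorff_dim m A \<le> hausdorff_dim m A'"
proof -
  have pre: "hausdorff_premeasure m t \<delta> A \<le> hausdorff_premeasure m t \<delta> A'" for t \<delta>
    unfolding hausdorff_premeasure_def using assms by (intro INF_superset_mono) auto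
  have "hausdorff_measure m t A \<le> hausdorff_measure m t A'" for t
    unfolding hausdorff_measure_def by (intro SUP_mono) (use pre in blast)
  hence "hausdorff_measure m t A = 0" if "hausdorff_measure m t A' = 0" for t
    using that by (metis le_zero_eq)
  thus ?thesis unfolding hausdorff_dim_def by (intro INF_superset_mono) auto
qed

section \<open>A discrete form of Frostman's lemma\<close>

text \<open>
  One level of a Vitali covering argument: take a disjoint subfamily of maximal cardinality, which
  exists because each member uses up at least \<open>c\<close> points of \<open>S\<close>.
\<close>

lemma maximal_disjoint_subfamily:
  fixes F :: "'a \<Rightarrow> 'b set"
  assumes "finite S" "c > 0" "\<And>y. y \<in> T \<Longrightarrow> F y \<subseteq> S" "\<And>y. y \<in> T \<Longrightarrow> c \<le> real (card (F y))"
  obtains Y where "finite Y" "Y \<subseteq> T" "real (card Y) * c \<le> real (card S)"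
    "\<And>y. y \<in> T \<Longrightarrow> \<exists>y'\<in>Y. F y \<inter> F y' \<noteq> {}"
proof -
  define ok where "ok Y \<longleftrightarrow> finite Y \<and> Y \<subseteq> T \<and> disjoint_family_on F Y" for Y
  have bound: "real (card Y) * c \<le> real (card S)" if "ok Y" for Y
  proof -
    have "real (card Y) * c = (\<Sum>y\<in>Y. c)" by simp
    also have "\<dots> \<le> (\<Sum>y\<in>Y. real (card (F y)))"
      using that assms(4) by (intro sum_mono) (auto simp: ok_def)
    also have "\<dots> = real (card (\<Union>y\<in>Y. F y))"
    proof (subst card_UN_disjoint)
      show "finite Y" using that by (simp add: ok_def)
      show "\<forall>y\<in>Y. finite (F y)" using that assms(1,3) unfolding ok_def by (meson finite_subset subsetD)
      show "\<forall>y\<in>Y. \<forall>z\<in>Y. y \<noteq> z \<longrightarrow> F y \<inter> F z = {}"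
        using that by (auto simp: ok_def disjoint_family_on_def)
    qed simp
    also have "\<dots> \<le> real (card S)"
      using that assms(1,3) by (intro of_nat_mono card_mono) (auto simp: ok_def)
    finally show ?thesis .
  qed
  have lim: "card Y < nat \<lceil>real (card S) / c\<rceil> + 1" if "ok Y" for Y
  proof -
    have "real (card Y) \<le> real (card S) / c" using bound[OF that] assms(2) by (simp add: field_simps)
    thus ?thesis by linarith
  qed
  have "ok {}" by (auto simp: ok_def disjoint_family_on_def)
  then obtain Y where Y: "ok Y" "\<And>Y'. ok Y' \<Longrightarrow> card Y' \<le> card Y"
    using ex_has_greatest_nat[of ok "{}" card] lim by blast
  have "\<exists>y'\<in>Y. F y \<inter> F y' \<noteq> {}" if y: "y \<in> T" for y
  proof (rule ccontr)
    assume no: "\<not> (\<exists>y'\<in>Y. F y \<inter> F y' \<noteq> {})"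
    have "F y \<noteq> {}" using assms(2,4) y by fastforce
    hence "y \<notin> Y" using no by blast
    moreover have "ok (insert y Y)"
      using Y(1) no y by (auto simp: ok_def disjoint_family_on_def)
    moreover have "finite Y" using Y(1) by (simp add: ok_def)
    ultimately show False using Y(2)[of "insert y Y"] by simp
  qed
  moreover have "finite Y" "Y \<subseteq> T" using Y(1) by (auto simp: ok_def)
  ultimately show ?thesis using bound[OF Y(1)] by (intro that)
qed

text \<open>
  Take \<open>S\<close> of maximal cardinality among the finite sets that obey the bounds on balls. By
  maximality every point of \<open>A\<close> lies in a ball, of some radius \<open>\<Lambda> / 2\<^sup>j\<close>, whose bound is attained up
  to a factor \<open>2\<close>. At each level \<open>j\<close> a maximal disjoint subfamily of these saturated balls, enlarged
  three times, covers the others, and its number of balls is controlled by \<open>card S\<close>. Adding up the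
  levels instead of selecting disjoint balls across all of them costs the factor \<open>l + 1\<close>.
\<close>

lemma discrete_frostman:
  fixes m :: "'a metric" and l :: nat
  assumes A: "A \<subseteq> mspace m" and L: "\<Lambda> > 0" "\<And>x y. x \<in> A \<Longrightarrow> y \<in> A \<Longrightarrow> mdist m x y \<le> \<Lambda>"
    and s: "0 \<le> s"
  obtains S where "finite S" "S \<subseteq> A"
    "\<And>x j. x \<in> A \<Longrightarrow> j \<le> l \<Longrightarrow> real (card {y\<in>S. mdist m x y \<le> \<Lambda> / 2^j}) \<le> 2 powr (s * (real l - real j))"
    "hcontent (mdist m) s A \<le> ennreal (2 * (6 * \<Lambda>) powr s * (real l + 1) * (real (card S) * 2 powr (- s * real l)))"
proof -
  define B where "B x j = {y. mdist m x y \<le> \<Lambda> / 2^j}" for x and j :: nat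
  define cap where "cap j = 2 powr (s * (real l - real j))" for j :: nat
  define good where "good S \<longleftrightarrow> finite S \<and> S \<subseteq> A \<and> (\<forall>x\<in>A. \<forall>j\<le>l. real (card (S \<inter> B x j)) \<le> cap j)" for S
  have cap1: "1 \<le> cap j" if "j \<le> l" for j
    unfolding cap_def using s that by (intro ge_one_powr_ge_zero) auto
  have g0: "good {}" by (auto simp: good_def cap_def)
  have lim: "card S < nat \<lceil>cap 0\<rceil> + 1" if g: "good S" for S
  proof (cases "A = {}")
    case False
    then obtain x where x: "x \<in> A" by blast
    have "S \<inter> B x 0 = S" using g x L(2) by (auto simp: good_def B_def)
    moreover have "real (card (S \<inter> B x 0)) \<le> cap 0" using g x unfolding good_def by blast
    ultimately have "real (card S) \<le> cap 0" by simp
    thus ?thesis by linarith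
  qed (use g in \<open>auto simp: good_def\<close>)
  obtain S where S: "good S" "\<And>S'. good S' \<Longrightarrow> card S' \<le> card S"
    using ex_has_greatest_nat[of good "{}" card] lim g0 by blast
  have fin: "finite S" "S \<subseteq> A" and Scap: "\<And>x j. x \<in> A \<Longrightarrow> j \<le> l \<Longrightarrow> real (card (S \<inter> B x j)) \<le> cap j"
    using S(1) unfolding good_def by blast+
  define Sat where "Sat j = {y\<in>A. cap j / 2 \<le> real (card (S \<inter> B y j))}" for j
  have sat: "\<exists>j\<le>l. \<exists>y\<in>Sat j. mdist m y x \<le> \<Lambda> / 2^j" if x: "x \<in> A" for x
  proof (cases "x \<in> S")
    case True
    have xx: "mdist m x x = 0" using x A by auto
    hence "S \<inter> B x l \<noteq> {}" using True L(1) by (auto simp: B_def)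
    hence "0 < card (S \<inter> B x l)" using fin by (auto simp: card_gt_0_iff)
    hence "x \<in> Sat l" using x by (auto simp: Sat_def cap_def)
    thus ?thesis using L(1) xx by (intro exI[of _ l] conjI bexI[of _ x]) auto
  next
    case False
    hence "\<not> good (insert x S)" using S(2)[of "insert x S"] fin by auto
    then obtain y j where y: "y \<in> A" "j \<le> l" "\<not> real (card (insert x S \<inter> B y j)) \<le> cap j"
      using fin x unfolding good_def by auto
    hence xB: "x \<in> B y j" using Scap[OF y(1,2)] by (cases "x \<in> B y j") auto
    have "card (insert x S \<inter> B y j) = Suc (card (S \<inter> B y j))"
      using xB False fin by simp
    hence gt: "cap j < real (card (S \<inter> B y j)) + 1" using y by simp
    have "cap j / 2 \<le> real (card (S \<inter> B y j))"
    proof (cases "cap j < 2")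
      case True
      have "0 < card (S \<inter> B y j)" using gt cap1[OF y(2)] by linarith
      thus ?thesis using True by linarith
    qed (use gt in linarith)
    thus ?thesis using y xB by (auto simp: Sat_def B_def)
  qed
  have "\<exists>Y. finite Y \<and> Y \<subseteq> Sat j \<and> real (card Y) * (cap j / 2) \<le> real (card S) \<and>
      (\<forall>y\<in>Sat j. \<exists>y'\<in>Y. (S \<inter> B y j) \<inter> (S \<inter> B y' j) \<noteq> {})" for j
    by (rule maximal_disjoint_subfamily[OF fin(1), of "cap j / 2" "Sat j" "\<lambda>y. S \<inter> B y j"])
       (auto simp: Sat_def cap_def)
  then obtain Y where Y: "\<And>j. finite (Y j)" "\<And>j. Y j \<subseteq> Sat j"
    "\<And>j. real (card (Y j)) * (cap j / 2) \<le> real (card S)"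
    "\<And>j y. y \<in> Sat j \<Longrightarrow> \<exists>y'\<in>Y j. (S \<inter> B y j) \<inter> (S \<inter> B y' j) \<noteq> {}"
    by metis
  have YA: "Y j \<subseteq> mspace m" for j using Y(2) A by (auto simp: Sat_def)
  define I where "I = Sigma {..l} Y"
  define U where "U p = {x\<in>A. mdist m (snd p) x \<le> 3 * \<Lambda> / 2^fst p}" for p :: "nat \<times> 'a"
  have "hcontent (mdist m) s A \<le> ennreal (\<Sum>p\<in>I. (6 * \<Lambda> / 2^fst p) powr s)"
  proof (rule hcontent_le_finite[where U = U])
    show "finite I" unfolding I_def using Y(1) by auto
    show "A \<subseteq> (\<Union>p\<in>I. U p)"
    proof
      fix x assume x: "x \<in> A"
      from sat[OF x] obtain j y where j: "j \<le> l" "y \<in> Sat j" "mdist m y x \<le> \<Lambda> / 2^j" by blast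
      obtain y' z where y': "y' \<in> Y j" "z \<in> S" "z \<in> B y j" "z \<in> B y' j" using Y(4)[OF j(2)] by blast
      have ms: "x \<in> mspace m" "y \<in> mspace m" "y' \<in> mspace m" "z \<in> mspace m"
        using x j y' fin A YA by (auto simp: Sat_def)
      have "mdist m y' x \<le> mdist m y' z + mdist m z x" using ms by (intro mdist_triangle) auto
      also have "mdist m z x \<le> mdist m z y + mdist m y x" using ms by (intro mdist_triangle) auto
      also have "mdist m z y = mdist m y z" by (rule mdist_commute)
      finally have "mdist m y' x \<le> 3 * \<Lambda> / 2^j" using j y' by (auto simp: B_def)
      hence "x \<in> U (j, y')" using x by (auto simp: U_def)
      thus "x \<in> (\<Union>p\<in>I. U p)" using j y' by (force simp: I_def)
    qed
    fix p assume p: "p \<in> I"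
    show "diam_le (mdist m) (U p) (6 * \<Lambda> / 2^fst p)"
      unfolding diam_le_def
    proof (intro conjI ballI)
      fix x y assume xy: "x \<in> U p" "y \<in> U p"
      have ms: "x \<in> mspace m" "y \<in> mspace m" "snd p \<in> mspace m"
        using xy p A subsetD[OF YA, of "snd p" "fst p"] by (auto simp: U_def I_def)
      have "mdist m x y \<le> mdist m x (snd p) + mdist m (snd p) y" using ms by (intro mdist_triangle) auto
      also have "mdist m x (snd p) = mdist m (snd p) x" by (rule mdist_commute)
      finally show "mdist m x y \<le> 6 * \<Lambda> / 2^fst p" using xy by (auto simp: U_def)
    qed (use L in auto)
  qed
  also have "(\<Sum>p\<in>I. (6 * \<Lambda> / 2^fst p) powr s) = (\<Sum>j\<le>l. \<Sum>y\<in>Y j. (6 * \<Lambda> / 2^j) powr s)"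
    unfolding I_def using Y(1) by (subst sum.Sigma) (auto simp: case_prod_unfold)
  also have "\<dots> \<le> (\<Sum>j\<le>l. 2 * (6 * \<Lambda>) powr s * (real (card S) * 2 powr (- s * real l)))"
  proof (rule sum_mono)
    fix j assume j: "j \<in> {..l}"
    have cp: "cap j > 0" by (simp add: cap_def)
    have pw: "(6 * \<Lambda> / 2^j) powr s = (6 * \<Lambda>) powr s * 2 powr (- s * real j)"
    proof -
      have "6 * \<Lambda> / 2^j = (6 * \<Lambda>) * 2 powr (- real j)"
        by (simp add: powr_minus powr_realpow divide_inverse)
      thus ?thesis using L(1) by (simp add: powr_mult powr_powr mult.commute)
    qed
    have cc: "2 powr (- s * real j) = cap j * 2 powr (- s * real l)"
      unfolding cap_def by (simp add: algebra_simps flip: powr_add)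
    have "(\<Sum>y\<in>Y j. (6 * \<Lambda> / 2^j) powr s)
        = 2 * (6 * \<Lambda>) powr s * ((real (card (Y j)) * (cap j / 2)) * 2 powr (- s * real l))"
      unfolding pw cc by simp
    also have "\<dots> \<le> 2 * (6 * \<Lambda>) powr s * (real (card S) * 2 powr (- s * real l))"
      using Y(3)[of j] by (intro mult_left_mono mult_right_mono) auto
    finally show "(\<Sum>y\<in>Y j. (6 * \<Lambda> / 2^j) powr s)
        \<le> 2 * (6 * \<Lambda>) powr s * (real (card S) * 2 powr (- s * real l))" .
  qed
  also have "\<dots> = 2 * (6 * \<Lambda>) powr s * (real l + 1) * (real (card S) * 2 powr (- s * real l))"
    by (simp add: algebra_simps)
  finally have hc: "hcontent (mdist m) s A
      \<le> ennreal (2 * (6 * \<Lambda>) powr s * (real l + 1) * (real (card S) * 2 powr (- s * real l)))"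
    by (simp add: ennreal_leI)
  show ?thesis
  proof (rule that[OF fin _ hc])
    fix x j assume "x \<in> A" "j \<le> l"
    moreover have "{y\<in>S. mdist m x y \<le> \<Lambda> / 2^j} = S \<inter> B x j" by (auto simp: B_def)
    ultimately show "real (card {y\<in>S. mdist m x y \<le> \<Lambda> / 2^j}) \<le> 2 powr (s * (real l - real j))"
      using Scap[of x j] by (simp add: cap_def)
  qed
qed

text \<open>
  The Cauchy-Schwarz inequality for the function that counts, at each point of \<open>C\<close>, the sets \<open>X p\<close>
  containing it.
\<close>

lemma sum_card_square_le:
  assumes "finite S" "finite C" "\<And>p. p \<in> S \<Longrightarrow> X p \<subseteq> C"
  shows "(\<Sum>p\<in>S. real (card (X p)))\<^sup>2
    \<le> real (card C) * (\<Sum>p\<in>S. \<Sum>q\<in>S. real (card (X p \<inter> X q)))"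
proof -
  have card_X: "real (card (Z \<inter> W)) = (\<Sum>z\<in>C. of_bool (z \<in> Z) * of_bool (z \<in> W))"
    if "Z \<subseteq> C" for Z W
  proof -
    have "(\<Sum>z\<in>C. of_bool (z \<in> Z) * of_bool (z \<in> W)) = (\<Sum>z\<in>C. of_bool (z \<in> Z \<inter> W) :: real)"
      by (intro sum.cong) auto
    also have "\<dots> = real (card (C \<inter> (Z \<inter> W)))" using assms(2) by (simp add: Int_def)
    also have "C \<inter> (Z \<inter> W) = Z \<inter> W" using that by blast
    finally show ?thesis by simp
  qed
  define f :: "'b \<Rightarrow> real" where "f z = (\<Sum>p\<in>S. of_bool (z \<in> X p))" for z
  have "(\<Sum>p\<in>S. real (card (X p))) = (\<Sum>p\<in>S. \<Sum>z\<in>C. of_bool (z \<in> X p))"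
    using card_X[where W = UNIV] assms(3) by (intro sum.cong) auto
  also have "\<dots> = (\<Sum>z\<in>C. f z)" unfolding f_def by (rule sum.swap)
  finally have 1: "(\<Sum>p\<in>S. real (card (X p))) = (\<Sum>z\<in>C. f z)" .
  have "(\<Sum>z\<in>C. (f z)\<^sup>2) = (\<Sum>z\<in>C. \<Sum>p\<in>S. \<Sum>q\<in>S. of_bool (z \<in> X p) * of_bool (z \<in> X q))"
    unfolding f_def power2_eq_square sum_product ..
  also have "\<dots> = (\<Sum>p\<in>S. \<Sum>z\<in>C. \<Sum>q\<in>S. of_bool (z \<in> X p) * of_bool (z \<in> X q))"
    by (rule sum.swap)
  also have "\<dots> = (\<Sum>p\<in>S. \<Sum>q\<in>S. \<Sum>z\<in>C. of_bool (z \<in> X p) * of_bool (z \<in> X q))"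
    by (rule sum.cong[OF refl sum.swap])
  also have "\<dots> = (\<Sum>p\<in>S. \<Sum>q\<in>S. real (card (X p \<inter> X q)))"
    using card_X assms(3) by (intro sum.cong) auto
  finally show ?thesis
    using sum_squared_le_sum_of_squares[of f C] 1 by (simp add: mult.commute)
qed

section \<open>Orthogonal projections and the distance of affine subspaces\<close>

lemma orth_proj_mem:
  fixes V :: "(real ^ 'n) set"
  assumes "subspace V"
  shows "orth_proj V x \<in> V" and "x - orth_proj V x \<in> V\<^sup>\<bottom>"
  using theI'[OF orth_proj_ex1[OF assms, of x]] unfolding orth_proj_def by auto

lemma orth_proj_unique:
  fixes V :: "(real ^ 'n) set"
  assumes "subspace V" "y \<in> V" "x - y \<in> V\<^sup>\<bottom>"
  shows "orth_proj V x = y"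
  unfolding orth_proj_def using assms by (intro the1_equality orth_proj_ex1) auto

lemma linear_orth_proj:
  fixes V :: "(real ^ 'n) set"
  assumes V: "subspace V"
  shows "linear (orth_proj V)"
proof (rule linearI)
  note p = orth_proj_mem[OF V] and O = subspace_orthogonal_comp[of V]
  fix x y :: "real ^ 'n" and c :: real
  have "(x + y) - (orth_proj V x + orth_proj V y) \<in> V\<^sup>\<bottom>"
    using subspace_add[OF O p(2)[of x] p(2)[of y]] by (simp add: algebra_simps)
  thus "orth_proj V (x + y) = orth_proj V x + orth_proj V y"
    using p V by (intro orth_proj_unique) (auto simp: subspace_add)
  have "c *\<^sub>R x - c *\<^sub>R orth_proj V x \<in> V\<^sup>\<bottom>"
    using subspace_scale[OF O p(2)[of x], of c] by (simp add: algebra_simps)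
  thus "orth_proj V (c *\<^sub>R x) = c *\<^sub>R orth_proj V x"
    using p V by (intro orth_proj_unique) (auto simp: subspace_scale)
qed

lemma orthogonal_comp_inner: "u \<in> V\<^sup>\<bottom> \<Longrightarrow> v \<in> V \<Longrightarrow> inner u v = 0"
  by (auto simp: orthogonal_comp_def orthogonal_def inner_commute)

lemma orth_proj_pythagoras:
  fixes V :: "(real ^ 'n) set"
  assumes V: "subspace V" and v: "v \<in> V"
  shows "(norm (x - v))\<^sup>2 = (norm (x - orth_proj V x))\<^sup>2 + (norm (orth_proj V x - v))\<^sup>2"
proof -
  note p = orth_proj_mem[OF V]
  have "inner (x - orth_proj V x) (orth_proj V x - v) = 0"
    using p v V by (intro orthogonal_comp_inner) (auto simp: subspace_diff)
  hence "orthogonal (x - orth_proj V x) (orth_proj V x - v)" by (simp add: orthogonal_def)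
  from norm_add_Pythagorean[OF this] show ?thesis by simp
qed

lemma norm_orth_proj_le:
  fixes V :: "(real ^ 'n) set"
  assumes V: "subspace V"
  shows "norm (orth_proj V x) \<le> norm x" "norm (x - orth_proj V x) \<le> norm x"
    "v \<in> V \<Longrightarrow> norm (x - orth_proj V x) \<le> norm (x - v)"
proof -
  note q = orth_proj_pythagoras[OF V subspace_0[OF V], of x]
  show "norm (orth_proj V x) \<le> norm x" "norm (x - orth_proj V x) \<le> norm x"
    by (rule power2_le_imp_le; use q in simp)+
  show "norm (x - orth_proj V x) \<le> norm (x - v)" if "v \<in> V"
    by (rule power2_le_imp_le) (use orth_proj_pythagoras[OF V that, of x] in auto)
qed

lemma inner_orth_proj:
  fixes V :: "(real ^ 'n) set"
  assumes V: "subspace V"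
  shows "inner x (orth_proj V y) = inner (orth_proj V x) (orth_proj V y)"
proof -
  have "inner (x - orth_proj V x) (orth_proj V y) = 0"
    using orth_proj_mem[OF V] by (intro orthogonal_comp_inner)
  thus ?thesis by (simp add: inner_diff_left)
qed

text \<open>
  Write \<open>p\<close>, \<open>q\<close> for the two projections; then \<open>p - q = (1 - q) p - q (1 - p)\<close>. The hypothesis on \<open>V\<close>
  bounds \<open>(1 - q) p\<close>. The operator \<open>q (1 - p)\<close> is the adjoint of \<open>(1 - p) q\<close>, which the hypothesis on
  \<open>W\<close> bounds; the proof uses this duality in the form of a computation of \<open>norm (q y)\<close> for
  \<open>y = x - p x\<close>.
\<close>

lemma orth_proj_close:
  fixes V W :: "(real ^ 'n) set"
  assumes V: "subspace V" and W: "subspace W" and e: "0 \<le> e"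
    and VW: "\<And>v. v \<in> V \<Longrightarrow> \<exists>w\<in>W. norm (v - w) \<le> e * norm v"
    and WV: "\<And>w. w \<in> W \<Longrightarrow> \<exists>v\<in>V. norm (w - v) \<le> e * norm w"
  shows "norm (orth_proj V x - orth_proj W x) \<le> 2 * e * norm x"
proof -
  let ?p = "orth_proj V" and ?q = "orth_proj W"
  have A: "norm (v - ?q v) \<le> e * norm v" if "v \<in> V" for v
    using VW[OF that] norm_orth_proj_le(3)[OF W, of _ v] by force
  have B: "norm (w - ?p w) \<le> e * norm w" if "w \<in> W" for w
    using WV[OF that] norm_orth_proj_le(3)[OF V, of _ w] by force
  have 1: "norm (?p x - ?q (?p x)) \<le> e * norm x"
    using A[OF orth_proj_mem(1)[OF V], of x] norm_orth_proj_le(1)[OF V, of x] e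
    by (meson mult_left_mono order_trans)
  define y where "y = x - ?p x"
  have ypy: "inner y (?p (?q y)) = 0"
    unfolding y_def using orth_proj_mem[OF V] by (intro orthogonal_comp_inner)
  have "(norm (?q y))\<^sup>2 = inner y (?q y)"
    using inner_orth_proj[OF W, of y y] by (simp add: power2_norm_eq_inner)
  also have "\<dots> = inner y (?q y - ?p (?q y))" using ypy by (simp add: inner_diff_right)
  also have "\<dots> \<le> norm y * norm (?q y - ?p (?q y))" by (rule norm_cauchy_schwarz)
  also have "\<dots> \<le> norm y * (e * norm (?q y))"
    using B[OF orth_proj_mem(1)[OF W]] by (intro mult_left_mono) auto
  finally have "norm (?q y) * norm (?q y) \<le> (e * norm y) * norm (?q y)"
    by (simp add: power2_eq_square algebra_simps)
  hence "norm (?q y) \<le> e * norm y"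
    using e by (cases "norm (?q y) = 0") (auto dest: mult_right_le_imp_le)
  also have "\<dots> \<le> e * norm x"
    unfolding y_def using norm_orth_proj_le(2)[OF V, of x] e by (intro mult_left_mono)
  finally have 2: "norm (?q y) \<le> e * norm x" .
  have "?p x - ?q x = (?p x - ?q (?p x)) - ?q y"
    unfolding y_def by (simp add: linear_diff[OF linear_orth_proj[OF W]])
  hence "norm (?p x - ?q x) \<le> norm (?p x - ?q (?p x)) + norm (?q y)"
    using norm_triangle_ineq4 by metis
  thus ?thesis using 1 2 by simp
qed

lemma orth_form_direction_offset:
  fixes P :: "(real ^ 'n) set"
  assumes "P \<in> affine_subspaces k"
  shows "orth_form P (direction P) (offset P)"
  using orth_form_exists[OF assms] direction_offset_eq by metis

text \<open>
  The point of \<open>P\<close> closest to \<open>x\<close> is \<open>a + p x\<close>, with \<open>a\<close> the offset of \<open>P\<close> and \<open>p\<close> the projection onto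
  its direction, while \<open>x\<close> itself is the sum of the same two terms for \<open>P'\<close>.
\<close>

lemma affine_dist_nearby:
  fixes P P' :: "(real ^ 'n) set"
  assumes P: "P \<in> affine_subspaces k" and P': "P' \<in> affine_subspaces k" and x: "x \<in> P'"
  shows "\<exists>y\<in>P. norm (x - y) \<le> (1 + norm x) * affine_dist P P'"
proof -
  define V a V' a' where "V = direction P" "a = offset P" "V' = direction P'" "a' = offset P'"
  note defs = this
  have o: "orth_form P V a" "orth_form P' V' a'"
    using orth_form_direction_offset P P' defs by auto
  hence V: "subspace V" "subspace V'" by (auto simp: orth_form_def)
  let ?p = "orth_proj V" and ?q = "orth_proj V'"
  obtain v where v: "v \<in> V'" "x = a' + v" using o x by (auto simp: orth_form_def)
  have qx: "?q x = v" using v o V by (intro orth_proj_unique) (auto simp: orth_form_def)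
  have bl: "bounded_linear (\<lambda>x. ?p x - ?q x)"
    by (intro linear_conv_bounded_linear[THEN iffD1] linear_compose_sub linear_orth_proj V)
  let ?N = "onorm (\<lambda>x. ?p x - ?q x)"
  have N: "norm (?p x - ?q x) \<le> ?N * norm x" by (rule onorm[OF bl])
  have N0: "0 \<le> ?N" by (rule onorm_pos_le[OF bl])
  have "a + ?p x \<in> P" using o orth_proj_mem(1)[OF V(1)] by (auto simp: orth_form_def)
  moreover have "x - (a + ?p x) = - (a - a') - (?p x - ?q x)" using v qx by simp
  hence "norm (x - (a + ?p x)) \<le> norm (a - a') + norm (?p x - ?q x)"
    by (metis norm_minus_cancel norm_triangle_ineq4)
  moreover have "norm (a - a') + norm (?p x - ?q x) \<le> (1 + norm x) * affine_dist P P'"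
  proof -
    have "norm (a - a') + ?N * norm x \<le> (1 + norm x) * (?N + norm (a - a'))"
      using N0 by (simp add: algebra_simps)
    thus ?thesis using N unfolding affine_dist_def defs by linarith
  qed
  ultimately show ?thesis by force
qed

section \<open>Planes as graphs over coordinates\<close>

text \<open>
  The coefficients form a full matrix and a full vector whatever \<open>J\<close> is, so that graphs over different
  sets of coordinates have coefficients of the same type.
\<close>

definition graph_plane :: "'n set \<Rightarrow> real ^ 'n ^ 'n \<Rightarrow> real ^ 'n \<Rightarrow> (real ^ 'n) set" where
  "graph_plane J A b = {x. \<forall>i. i \<notin> J \<longrightarrow> x $ i = b $ i + (\<Sum>j\<in>J. A $ i $ j * x $ j)}"

lemma norm_le_card_bound:
  fixes x :: "real ^ 'n"
  assumes "\<And>i. \<bar>x $ i\<bar> \<le> c"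
  shows "norm x \<le> real CARD('n) * c"
proof -
  have "norm x \<le> (\<Sum>i\<in>UNIV. \<bar>x $ i\<bar>)" by (rule norm_le_l1_cart)
  also have "\<dots> \<le> (\<Sum>i\<in>(UNIV::'n set). c)" by (intro sum_mono assms)
  finally show ?thesis by simp
qed

lemma abs_sum_prod_bound:
  fixes f g :: "'n::finite \<Rightarrow> real"
  assumes "\<And>j. j \<in> J \<Longrightarrow> \<bar>f j\<bar> \<le> a" "\<And>j. j \<in> J \<Longrightarrow> \<bar>g j\<bar> \<le> c" "0 \<le> a" "0 \<le> c"
  shows "\<bar>\<Sum>j\<in>J. f j * g j\<bar> \<le> real CARD('n) * a * c"
proof -
  have "\<bar>\<Sum>j\<in>J. f j * g j\<bar> \<le> (\<Sum>j\<in>J. \<bar>f j * g j\<bar>)" by (rule sum_abs)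
  also have "\<dots> \<le> (\<Sum>j\<in>J. a * c)" unfolding abs_mult using assms by (intro sum_mono mult_mono) auto
  also have "\<dots> = real (card J) * (a * c)" by simp
  also have "\<dots> \<le> real CARD('n) * (a * c)"
    using assms by (intro mult_right_mono of_nat_mono card_mono) auto
  finally show ?thesis by (simp add: mult.assoc)
qed

lemma graph_plane_lipschitz:
  fixes x y :: "real ^ 'n"
  assumes "x \<in> graph_plane J A b" "y \<in> graph_plane J A b" "\<And>i j. \<bar>A $ i $ j\<bar> \<le> m"
    "\<And>j. j \<in> J \<Longrightarrow> \<bar>x $ j - y $ j\<bar> \<le> h" "0 \<le> h"
  shows "norm (x - y) \<le> real CARD('n) * ((1 + real CARD('n) * m) * h)"
proof (rule norm_le_card_bound)
  have m: "0 \<le> m" using assms(3) abs_ge_zero order_trans by blast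
  fix i show "\<bar>(x - y) $ i\<bar> \<le> (1 + real CARD('n) * m) * h"
  proof (cases "i \<in> J")
    case True
    have "h \<le> (1 + real CARD('n) * m) * h" using m assms(5) by (simp add: algebra_simps)
    thus ?thesis using assms(4)[OF True] by simp
  next
    case False
    have "(x - y) $ i = (\<Sum>j\<in>J. A $ i $ j * (x $ j - y $ j))"
      using assms(1,2) False by (simp add: graph_plane_def right_diff_distrib sum_subtractf)
    also have "\<bar>\<dots>\<bar> \<le> real CARD('n) * m * h"
      using assms m by (intro abs_sum_prod_bound) auto
    also have "\<dots> \<le> (1 + real CARD('n) * m) * h" using assms(5) by (simp add: algebra_simps)
    finally show ?thesis .
  qed
qed

lemma subspace_graph_plane: "subspace (graph_plane J A 0)"
  unfolding subspace_def graph_plane_def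
  by (auto simp: algebra_simps sum.distrib sum_distrib_left intro!: sum.cong)

text \<open>
  If \<open>b\<close> vanishes on \<open>J\<close>, it is itself a point of the graph, and its component orthogonal to the
  direction is the offset.
\<close>

lemma orth_form_graph_plane:
  fixes b :: "real ^ 'n"
  assumes b: "\<And>j. j \<in> J \<Longrightarrow> b $ j = 0"
  shows "orth_form (graph_plane J A b) (graph_plane J A 0) (b - orth_proj (graph_plane J A 0) b)"
proof -
  let ?V = "graph_plane J A 0" and ?p = "orth_proj (graph_plane J A 0)"
  note V = subspace_graph_plane[of J A]
  have tr: "b + v \<in> graph_plane J A b \<longleftrightarrow> v \<in> ?V" for v
    using b by (simp add: graph_plane_def)
  have "graph_plane J A b = (+) (b - ?p b) ` ?V"
  proof (intro set_eqI iffI)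
    fix x assume "x \<in> graph_plane J A b"
    hence "x - b \<in> ?V" using tr[of "x - b"] by simp
    hence "x - b + ?p b \<in> ?V" using orth_proj_mem(1)[OF V] subspace_add[OF V] by blast
    thus "x \<in> (+) (b - ?p b) ` ?V" by (rule image_eqI[rotated]) simp
  next
    fix x assume "x \<in> (+) (b - ?p b) ` ?V"
    then obtain v where v: "v \<in> ?V" "x = b + (v - ?p b)" by auto
    have "v - ?p b \<in> ?V" using v orth_proj_mem(1)[OF V] subspace_diff[OF V] by blast
    thus "x \<in> graph_plane J A b" using v tr by simp
  qed
  thus ?thesis using V orth_proj_mem(2)[OF V] by (simp add: orth_form_def)
qed

text \<open>
  A vector \<open>v\<close> of one direction is compared with the vector of the other direction that has the
  same coordinates in \<open>J\<close>; their difference is linear in the coefficient differences.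
  \<open>orth_proj_close\<close> turns this into a bound for the projections, and the offsets are projections
  of \<open>b\<close> and \<open>b'\<close>.
\<close>

lemma affine_dist_graph_plane_le:
  fixes b b' :: "real ^ 'n"
  defines "n \<equiv> real CARD('n)"
  assumes b: "\<And>j. j \<in> J \<Longrightarrow> b $ j = 0" "\<And>j. j \<in> J \<Longrightarrow> b' $ j = 0"
    and m: "\<And>i. \<bar>b' $ i\<bar> \<le> m"
    and D: "\<And>i j. i \<notin> J \<Longrightarrow> j \<in> J \<Longrightarrow> \<bar>A $ i $ j - A' $ i $ j\<bar> \<le> D" "\<And>i. \<bar>b $ i - b' $ i\<bar> \<le> D"
  shows "affine_dist (graph_plane J A b) (graph_plane J A' b') \<le> (2 * n\<^sup>2 + n + 2 * n^3 * m) * D"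
proof -
  have D0: "0 \<le> D" using D(2) abs_ge_zero order_trans by blast
  have near: "\<exists>w\<in>graph_plane J M' 0. norm (v - w) \<le> (n\<^sup>2 * D) * norm v"
    if v: "v \<in> graph_plane J M 0" and DM: "\<And>i j. i \<notin> J \<Longrightarrow> j \<in> J \<Longrightarrow> \<bar>M $ i $ j - M' $ i $ j\<bar> \<le> D"
    for v :: "real ^ 'n" and M M' :: "real ^ 'n ^ 'n"
  proof -
    define w :: "real ^ 'n" where "w = (\<chi> i. if i \<in> J then v $ i else \<Sum>j\<in>J. M' $ i $ j * v $ j)"
    have "w \<in> graph_plane J M' 0" by (simp add: graph_plane_def w_def)
    moreover have "norm (v - w) \<le> real CARD('n) * (real CARD('n) * D * norm v)"
    proof (rule norm_le_card_bound)
      fix i show "\<bar>(v - w) $ i\<bar> \<le> real CARD('n) * D * norm v"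
      proof (cases "i \<in> J")
        case False
        have "(v - w) $ i = (\<Sum>j\<in>J. (M $ i $ j - M' $ i $ j) * v $ j)"
          using v False by (simp add: graph_plane_def w_def left_diff_distrib sum_subtractf)
        thus ?thesis using DM[OF False] D0 component_le_norm_cart[of v] by (auto intro!: abs_sum_prod_bound)
      qed (use D0 in \<open>simp add: w_def\<close>)
    qed
    ultimately show ?thesis by (auto simp: n_def power2_eq_square mult.assoc)
  qed
  let ?V = "graph_plane J A 0" and ?W = "graph_plane J A' 0"
  let ?p = "orth_proj ?V" and ?q = "orth_proj ?W"
  note V = subspace_graph_plane[of J A] and W = subspace_graph_plane[of J A']
  have cl: "norm (?p x - ?q x) \<le> 2 * (n\<^sup>2 * D) * norm x" for x
    using D near D0 by (intro orth_proj_close V W) (auto simp: abs_minus_commute)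
  have "onorm (\<lambda>x. ?p x - ?q x) \<le> 2 * (n\<^sup>2 * D)"
    using cl D0 by (intro onorm_bound) auto
  moreover have "norm ((b - ?p b) - (b' - ?q b')) \<le> n * D + 2 * (n\<^sup>2 * D) * (n * m)"
  proof -
    have "(b - ?p b) - (b' - ?q b') = ((b - b') - ?p (b - b')) - (?p b' - ?q b')"
      by (simp add: linear_diff[OF linear_orth_proj[OF V]])
    hence "norm ((b - ?p b) - (b' - ?q b')) \<le> norm ((b - b') - ?p (b - b')) + norm (?p b' - ?q b')"
      by (metis norm_triangle_ineq4)
    moreover have "norm ((b - b') - ?p (b - b')) \<le> n * D"
      using norm_orth_proj_le(2)[OF V, of "b - b'"] norm_le_card_bound[of "b - b'" D] D(2)
      by (auto simp: n_def)
    moreover have "norm b' \<le> n * m" unfolding n_def using m by (rule norm_le_card_bound)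
    hence "2 * (n\<^sup>2 * D) * norm b' \<le> 2 * (n\<^sup>2 * D) * (n * m)" using D0 by (intro mult_left_mono) auto
    ultimately show ?thesis using cl[of b'] by linarith
  qed
  ultimately have "affine_dist (graph_plane J A b) (graph_plane J A' b')
      \<le> 2 * (n\<^sup>2 * D) + (n * D + 2 * (n\<^sup>2 * D) * (n * m))"
    using orth_form_graph_plane[of J b A] orth_form_graph_plane[of J b' A'] b
    by (simp add: affine_dist_def direction_offset_eq)
  thus ?thesis by (simp add: algebra_simps power2_eq_square power3_eq_cube)
qed

text \<open>
  Let \<open>I\<close> be a maximal set of coordinates such that \<open>V\<close> contains no nonzero vector supported in \<open>I\<close>,
  and let \<open>J\<close> be its complement. Vectors of \<open>V\<close> are determined by their coordinates in \<open>J\<close>. By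
  maximality, for each \<open>j \<in> J\<close> some \<open>e j \<in> V\<close> restricts to the \<open>j\<close>-th unit vector on \<open>J\<close>; these vectors
  form a basis of \<open>V\<close> and the columns of \<open>A\<close>.
\<close>

lemma subspace_is_graph_plane:
  fixes V :: "(real ^ 'n) set"
  assumes V: "subspace V"
  obtains J A where "V = graph_plane J A 0" "card J = dim V"
proof -
  define free where "free I \<longleftrightarrow> (\<forall>v\<in>V. (\<forall>j. j \<notin> I \<longrightarrow> v $ j = 0) \<longrightarrow> v = 0)" for I
  have "free {}" by (auto simp: free_def vec_eq_iff)
  then obtain I where I: "free I" "\<And>I'. free I' \<Longrightarrow> card I' \<le> card I"
    using ex_has_greatest_nat[of free "{}" card "CARD('n) + 1"]
    by (metis card_mono finite le_imp_less_Suc Suc_eq_plus1 subset_UNIV)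
  define J where "J = - I"
  have "\<exists>v\<in>V. v $ j = 1 \<and> (\<forall>j'\<in>J - {j}. v $ j' = 0)" if j: "j \<in> J" for j
  proof -
    have "card (insert j I) > card I" using j by (simp add: J_def)
    hence "\<not> free (insert j I)" using I(2) leD by blast
    then obtain v where v: "v \<in> V" "\<And>i. i \<notin> insert j I \<Longrightarrow> v $ i = 0" "v \<noteq> 0"
      unfolding free_def by blast
    have "v $ j \<noteq> 0"
    proof
      assume "v $ j = 0"
      hence "\<And>i. i \<notin> I \<Longrightarrow> v $ i = 0" using v(2) by (metis insertE)
      thus False using I(1) v unfolding free_def by blast
    qed
    thus ?thesis using v V
      by (intro bexI[of _ "inverse (v $ j) *\<^sub>R v"]) (auto simp: J_def subspace_scale)
  qed
  then obtain e where e: "\<And>j. j \<in> J \<Longrightarrow> e j \<in> V" "\<And>j. j \<in> J \<Longrightarrow> e j $ j = 1"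
    "\<And>j j'. j \<in> J \<Longrightarrow> j' \<in> J \<Longrightarrow> j' \<noteq> j \<Longrightarrow> e j $ j' = 0" by (metis Diff_iff singletonD)
  define A :: "real ^ 'n ^ 'n" where "A = (\<chi> i j. e j $ i)"
  define L where "L x = (\<Sum>j\<in>J. x $ j *\<^sub>R e j)" for x :: "real ^ 'n"
  have comb: "L x \<in> V" for x :: "real ^ 'n"
    unfolding L_def using e V by (auto intro!: subspace_sum subspace_scale)
  have combJ: "L x $ i = x $ i" if "i \<in> J" for x :: "real ^ 'n" and i
  proof -
    have "L x $ i = (\<Sum>j\<in>J. if j = i then x $ i else 0)"
      unfolding L_def sum_component using e that by (intro sum.cong) auto
    thus ?thesis using that by simp
  qed
  have eq: "x \<in> V" "x \<in> graph_plane J A 0" if "x = L x" for x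
  proof -
    show "x \<in> V" by (subst that) (rule comb)
    have "L x $ i = (0 :: real ^ 'n) $ i + (\<Sum>j\<in>J. A $ i $ j * x $ j)" for i
      by (simp add: L_def A_def mult.commute)
    hence "x $ i = (0 :: real ^ 'n) $ i + (\<Sum>j\<in>J. A $ i $ j * x $ j)" for i by (subst (1) that)
    thus "x \<in> graph_plane J A 0" unfolding graph_plane_def by blast
  qed
  have expV: "x = L x" if "x \<in> V" for x
  proof -
    have "x - L x \<in> V" using that comb V by (simp add: subspace_diff)
    moreover have "\<And>i. i \<notin> I \<Longrightarrow> (x - L x) $ i = 0"
      using combJ by (simp add: J_def)
    ultimately have "x - L x = 0" using I(1) unfolding free_def by blast
    thus ?thesis by simp
  qed
  have expG: "x = L x" if "x \<in> graph_plane J A 0" for x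
    unfolding vec_eq_iff
  proof
    fix i show "x $ i = L x $ i"
    proof (cases "i \<in> J")
      case False
      thus ?thesis using that by (simp add: graph_plane_def L_def A_def mult.commute)
    qed (simp add: combJ)
  qed
  have VG: "V = graph_plane J A 0" using eq expV expG by blast
  define f :: "real ^ 'n \<Rightarrow> real ^ 'n" where "f x = (\<chi> i. if i \<in> J then x $ i else 0)" for x
  have f: "linear f" by (rule linearI) (auto simp: f_def vec_eq_iff)
  have "inj_on f (span V)"
  proof (rule inj_onI)
    fix x y assume xy: "x \<in> span V" "y \<in> span V" "f x = f y"
    have VV: "span V = V" using V by (simp add: span_eq_iff)
    have "x $ j = y $ j" if "j \<in> J" for j
      using xy(3) that by (auto simp: f_def vec_eq_iff split: if_splits)
    hence "L x = L y" by (simp add: L_def)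
    thus "x = y" using expV[of x] expV[of y] xy(1,2) unfolding VV by metis
  qed
  hence "dim (f ` V) = dim V" by (rule dim_image_eq[OF f])
  moreover have "f ` V = {x. \<forall>i. i \<notin> J \<longrightarrow> x $ i = 0}"
  proof (intro set_eqI iffI)
    fix x :: "real ^ 'n" assume "x \<in> {x. \<forall>i. i \<notin> J \<longrightarrow> x $ i = 0}"
    hence "x = f (L x)" using combJ by (auto simp: f_def vec_eq_iff)
    thus "x \<in> f ` V" using comb by blast
  qed (auto simp: f_def)
  ultimately have "card J = dim V"
    using dim_substandard_cart[of J, where ?'a = real, unfolded dim_vec_eq] by simp
  thus ?thesis using that VG by blast
qed

text \<open>
  The bound \<open>m\<close> makes all constants below uniform on a chart, and every plane lies in some chart
  with an integral bound, so countably many charts suffice.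
\<close>

definition plane_chart :: "'n set \<Rightarrow> real \<Rightarrow> (real ^ 'n) set set" where
  "plane_chart J m = {P. \<exists>A b. P = graph_plane J A b \<and> (\<forall>j\<in>J. b $ j = 0) \<and>
     (\<forall>i j. \<bar>A $ i $ j\<bar> \<le> m) \<and> (\<forall>i. \<bar>b $ i\<bar> \<le> m)}"

lemma plane_chart_mono: "m \<le> m' \<Longrightarrow> plane_chart J m \<subseteq> plane_chart J m'"
proof
  fix P assume mm: "m \<le> m'" and "P \<in> plane_chart J m"
  then obtain A b where *: "P = graph_plane J A b" "\<forall>j\<in>J. b $ j = 0"
    "\<And>i j. \<bar>A $ i $ j\<bar> \<le> m" "\<And>i. \<bar>b $ i\<bar> \<le> m"
    unfolding plane_chart_def by blast
  have "\<bar>A $ i $ j\<bar> \<le> m'" "\<bar>b $ i\<bar> \<le> m'" for i j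
    using *(3)[of i j] *(4)[of i] mm by linarith+
  thus "P \<in> plane_chart J m'" using *(1,2) unfolding plane_chart_def by blast
qed

lemma affine_subspace_in_chart:
  fixes P :: "(real ^ 'n) set"
  assumes "P \<in> affine_subspaces k"
  obtains J m where "card J = k" "P \<in> plane_chart J m"
proof -
  obtain V a where o: "orth_form P V a" "dim V = k" by (rule orth_form_exists[OF assms])
  then obtain J A where J: "V = graph_plane J A 0" "card J = k"
    using subspace_is_graph_plane[of V] by (metis orth_form_def)
  define b :: "real ^ 'n" where "b = (\<chi> i. if i \<in> J then 0 else a $ i - (\<Sum>j\<in>J. A $ i $ j * a $ j))"
  have "P = (+) a ` V" using o by (simp add: orth_form_def)
  also have "\<dots> = graph_plane J A b"
  proof (intro set_eqI iffI)
    fix x assume "x \<in> graph_plane J A b"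
    hence "x - a \<in> V"
      unfolding J by (simp add: graph_plane_def b_def right_diff_distrib sum_subtractf)
    thus "x \<in> (+) a ` V" by (rule image_eqI[rotated]) simp
  qed (auto simp: J graph_plane_def b_def distrib_left sum.distrib)
  finally have P: "P = graph_plane J A b" .
  define m where "m = (\<Sum>i\<in>UNIV. \<Sum>j\<in>UNIV. \<bar>A $ i $ j\<bar>) + (\<Sum>i\<in>UNIV. \<bar>b $ i\<bar>)"
  have "\<bar>A $ i $ j\<bar> \<le> m" for i j
  proof -
    have "\<bar>A $ i $ j\<bar> \<le> (\<Sum>j\<in>UNIV. \<bar>A $ i $ j\<bar>)" by (rule member_le_sum) auto
    also have "\<dots> \<le> (\<Sum>i\<in>UNIV. \<Sum>j\<in>UNIV. \<bar>A $ i $ j\<bar>)"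
      by (rule member_le_sum[where f = "\<lambda>i. \<Sum>j\<in>UNIV. \<bar>A $ i $ j\<bar>"]) (auto intro: sum_nonneg)
    finally show ?thesis unfolding m_def by (simp add: sum_nonneg add_increasing2)
  qed
  moreover have "\<bar>b $ i\<bar> \<le> m" for i
  proof -
    have "\<bar>b $ i\<bar> \<le> (\<Sum>i\<in>UNIV. \<bar>b $ i\<bar>)" by (rule member_le_sum) auto
    thus ?thesis unfolding m_def by (simp add: sum_nonneg add_increasing)
  qed
  ultimately have "P \<in> plane_chart J m"
    unfolding plane_chart_def using P by (auto simp: b_def intro!: exI[of _ A] exI[of _ b])
  thus ?thesis using that J(2) by blast
qed

section \<open>The upper bound for unions of planes\<close>

lemma hcontent_zero_lipschitz:
  assumes z: "hcontent d' t A = 0" and K: "K > 0" and t: "t > 0"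
    and le: "\<And>x y. x \<in> A \<Longrightarrow> y \<in> A \<Longrightarrow> d x y \<le> K * d' x y"
  shows "hcontent d t A = 0"
proof -
  have "hcontent d t A \<le> 0 + ennreal e" if e: "e > 0" for e
  proof -
    have "0 < e / K powr t" using e K by simp
    from hcontent_zero_cover[OF z t this] obtain U r where
      U: "A \<subseteq> (\<Union>i. U i)" "\<And>i::nat. diam_le d' (U i) (r i)" "\<And>i. 0 < r i"
        "summable (\<lambda>i. r i powr t)" "(\<Sum>i. r i powr t) \<le> e / K powr t" by metis
    have pw: "(K * r i) powr t = K powr t * r i powr t" for i
      using K U(3)[of i] by (simp add: powr_mult)
    have "hcontent d t A \<le> (\<Sum>i. ennreal ((K * r i) powr t))"
    proof (rule hcontent_le[where U = "\<lambda>i. U i \<inter> A"])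
      show "diam_le d (U i \<inter> A) (K * r i)" for i
        unfolding diam_le_def
      proof (intro conjI ballI)
        fix x y assume "x \<in> U i \<inter> A" "y \<in> U i \<inter> A"
        moreover from this have "d' x y \<le> r i" using U(2)[of i] by (auto simp: diam_le_def)
        hence "K * d' x y \<le> K * r i" using K by simp
        ultimately show "d x y \<le> K * r i" using le[of x y] by auto
      qed (use K U(3)[of i] in auto)
    qed (use U(1) in auto)
    also have "\<dots> = ennreal (\<Sum>i. K powr t * r i powr t)"
      unfolding pw by (rule suminf_ennreal2) (use U(4) in auto)
    also have "(\<Sum>i. K powr t * r i powr t) = K powr t * (\<Sum>i. r i powr t)"
      by (rule suminf_mult[OF U(4)])
    also have "\<dots> \<le> K powr t * (e / K powr t)" using U(5) by (intro mult_left_mono) auto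
    also have "\<dots> = e" using K by simp
    finally show ?thesis by (simp add: ennreal_leI)
  qed
  hence "hcontent d t A \<le> 0" by (rule ennreal_le_epsilon)
  thus ?thesis by simp
qed

text \<open>
  The pieces consist of the points whose coordinates in \<open>J\<close> lie in the same cube of side \<open>r\<close>. Two
  points of one plane in the same piece are \<open>O(r)\<close>-close because the plane is a graph with bounded
  slope over \<open>J\<close>; passing from a plane of \<open>\<U>\<close> to another one moves points of the ball by \<open>O(r)\<close>. In
  \<open>((2 R + 5) / r) ^ k\<close> the constant \<open>5\<close> absorbs the rounding of \<open>R / r\<close>, by \<open>r \<le> 1\<close>.
\<close>

lemma hcontent_planes_le:
  fixes \<U> :: "(real ^ 'n) set set" and m R u r :: real
  defines "n \<equiv> real CARD('n)"
  defines "c \<equiv> n * ((1 + n * m) * (2 + R)) + (1 + R)"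
  assumes U: "\<U> \<subseteq> affine_subspaces k" "\<U> \<subseteq> plane_chart J m" "card J = k"
    and d: "\<And>P P'. P \<in> \<U> \<Longrightarrow> P' \<in> \<U> \<Longrightarrow> affine_dist P P' \<le> r"
    and r: "0 < r" "r \<le> 1" and R: "0 \<le> R" and m: "0 \<le> m"
  shows "hcontent dist u (\<Union>\<U> \<inter> cball 0 R) \<le> ennreal (((2 * R + 5) ^ k * c powr u) * r powr (u - real k))"
proof -
  define M where "M = \<lceil>R / r\<rceil> + 1"
  define I where "I = (PiE J (\<lambda>_. {-M..M}))"
  define V where "V w = {x \<in> \<Union>\<U> \<inter> cball 0 R. \<forall>j\<in>J. \<lfloor>x $ j / r\<rfloor> = w j}" for w
  have finJ: "finite J" by simp
  have c0: "0 \<le> c" using R m by (simp add: c_def n_def)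
  have M1: "1 \<le> M" 
  proof -
    have "0 \<le> R / r" using R r by simp
    thus ?thesis unfolding M_def by linarith
  qed
  have "hcontent dist u (\<Union>\<U> \<inter> cball 0 R) \<le> ennreal (\<Sum>w\<in>I. (c * r) powr u)"
  proof (rule hcontent_le_finite[where U = V])
    show "finite I" unfolding I_def by (intro finite_PiE) auto
    show "\<Union>\<U> \<inter> cball 0 R \<subseteq> (\<Union>w\<in>I. V w)"
    proof
      fix x assume x: "x \<in> \<Union>\<U> \<inter> cball 0 R"
      define w where "w = restrict (\<lambda>j. \<lfloor>x $ j / r\<rfloor>) J"
      have "\<lfloor>x $ j / r\<rfloor> \<in> {-M..M}" for j
      proof -
        have "\<bar>x $ j\<bar> \<le> R" using component_le_norm_cart[of x j] x by auto
        hence "\<bar>x $ j / r\<bar> \<le> R / r" using r by (simp add: divide_right_mono)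
        thus ?thesis unfolding M_def atLeastAtMost_iff by linarith
      qed
      hence "w \<in> I" by (auto simp: w_def I_def)
      moreover have "x \<in> V w" using x by (auto simp: V_def w_def)
      ultimately show "x \<in> (\<Union>w\<in>I. V w)" by blast
    qed
    fix w assume "w \<in> I"
    show "diam_le dist (V w) (c * r)"
      unfolding diam_le_def
    proof (intro conjI ballI)
      fix x x' assume x: "x \<in> V w" and x': "x' \<in> V w"
      obtain P P' where P: "P \<in> \<U>" "x \<in> P" "P' \<in> \<U>" "x' \<in> P'" using x x' by (auto simp: V_def)
      obtain A b where Ab: "P = graph_plane J A b" "\<And>i j. \<bar>A $ i $ j\<bar> \<le> m"
        using P(1) U(2) by (auto simp: plane_chart_def)
      have nx': "norm x' \<le> R" using x' by (auto simp: V_def)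
      obtain y where y: "y \<in> P" "norm (x' - y) \<le> (1 + norm x') * affine_dist P P'"
        using affine_dist_nearby[of P k P' x'] P U(1) by auto
      have "(1 + norm x') * affine_dist P P' \<le> (1 + norm x') * r"
        using d[OF P(1,3)] by (intro mult_left_mono) auto
      also have "\<dots> \<le> (1 + R) * r" using nx' r by (intro mult_right_mono) auto
      finally have y2: "norm (x' - y) \<le> (1 + R) * r" using y by simp
      have "norm (x - y) \<le> real CARD('n) * ((1 + real CARD('n) * m) * ((2 + R) * r))"
      proof (rule graph_plane_lipschitz)
        show "x \<in> graph_plane J A b" "y \<in> graph_plane J A b" using P y Ab by auto
        fix j assume j: "j \<in> J"
        have "\<lfloor>x $ j / r\<rfloor> = \<lfloor>x' $ j / r\<rfloor>" using x x' j by (auto simp: V_def)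
        hence "\<bar>x $ j / r - x' $ j / r\<bar> \<le> 1" by linarith
        hence "\<bar>x $ j - x' $ j\<bar> \<le> r" using r by (simp add: field_simps flip: diff_divide_distrib)
        moreover have "\<bar>x' $ j - y $ j\<bar> \<le> (1 + R) * r"
          using component_le_norm_cart[of "x' - y" j] y2 by simp
        ultimately have "\<bar>x $ j - y $ j\<bar> \<le> r + (1 + R) * r" by linarith
        thus "\<bar>x $ j - y $ j\<bar> \<le> (2 + R) * r" by (simp add: algebra_simps)
      qed (use Ab R r in auto)
      moreover have "dist x x' \<le> norm (x - y) + norm (x' - y)"
        by (metis dist_norm dist_triangle2)
      ultimately have "dist x x' \<le> n * ((1 + n * m) * ((2 + R) * r)) + (1 + R) * r"
        using y2 unfolding n_def by linarith
      thus "dist x x' \<le> c * r" unfolding c_def by (simp add: algebra_simps)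
    qed (use c0 r in auto)
  qed
  also have "(\<Sum>w\<in>I. (c * r) powr u) = (2 * real_of_int M + 1) ^ k * (c powr u * r powr u)"
  proof -
    have "card I = nat (2 * M + 1) ^ k"
      unfolding I_def using U(3) by (simp add: card_PiE algebra_simps)
    thus ?thesis using c0 r M1 by (simp add: powr_mult)
  qed
  also have "\<dots> \<le> ((2 * R + 5) / r) ^ k * (c powr u * r powr u)"
  proof (intro mult_right_mono power_mono)
    have "real_of_int M \<le> R / r + 2" unfolding M_def by linarith
    moreover have "1 \<le> 1 / r" using r by simp
    ultimately have "2 * real_of_int M + 1 \<le> 2 * (R / r) + 5 * (1 / r)" by linarith
    thus "2 * real_of_int M + 1 \<le> (2 * R + 5) / r" by (simp add: add_divide_distrib)
  qed (use M1 in auto)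
  also have "\<dots> = ((2 * R + 5) ^ k * c powr u) * r powr (u - real k)"
    using r by (simp add: powr_diff powr_realpow power_divide)
  finally show ?thesis by (simp add: ennreal_leI)
qed

lemma hcontent_Union_chart_zero:
  fixes E :: "(real ^ 'n) set set"
  assumes E: "E \<subseteq> affine_subspaces k" "E \<subseteq> plane_chart J m" "card J = k"
    and t: "0 < t" and z: "hcontent affine_dist t E = 0" and R: "0 \<le> R" and m: "0 \<le> m"
  shows "hcontent dist (t + real k) (\<Union>E \<inter> cball 0 R) = 0"
proof -
  define n where "n = real CARD('n)"
  define c where "c = n * ((1 + n * m) * (2 + R)) + (1 + R)"
  define C where "C = (2 * R + 5) ^ k * c powr (t + real k) + 1"
  have C: "0 < C" using R by (simp add: C_def add_nonneg_pos)
  have "hcontent dist (t + real k) (\<Union>E \<inter> cball 0 R) \<le> 0 + ennreal e" if e: "e > 0" for e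
  proof -
    have "0 < min 1 (e / C)" using e C by simp
    from hcontent_zero_cover[OF z t this] obtain U r where
      U: "E \<subseteq> (\<Union>i. U i)" "\<And>i::nat. diam_le affine_dist (U i) (r i)" "\<And>i. 0 < r i"
        "summable (\<lambda>i. r i powr t)" "(\<Sum>i. r i powr t) \<le> min 1 (e / C)" by metis
    have r1: "r i \<le> 1" for i
    proof (rule ccontr)
      assume "\<not> r i \<le> 1"
      hence "1 < r i powr t" using t by (simp add: gr_one_powr)
      also have "r i powr t \<le> (\<Sum>i. r i powr t)"
        using sum_le_suminf[OF U(4), of "{i}"] by simp
      finally show False using U(5) by simp
    qed
    have "hcontent dist (t + real k) (\<Union>E \<inter> cball 0 R)
        \<le> hcontent dist (t + real k) (\<Union>i. \<Union>(U i \<inter> E) \<inter> cball 0 R)"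
      using U(1) by (intro hcontent_mono) blast
    also have "\<dots> \<le> (\<Sum>i. hcontent dist (t + real k) (\<Union>(U i \<inter> E) \<inter> cball 0 R))"
      by (rule hcontent_UN_le)
    also have "\<dots> \<le> (\<Sum>i. ennreal (C * r i powr t))"
    proof (intro suminf_le allI)
      fix i
      have "hcontent dist (t + real k) (\<Union>(U i \<inter> E) \<inter> cball 0 R)
        \<le> ennreal (((2 * R + 5) ^ k * c powr (t + real k)) * r i powr ((t + real k) - real k))"
        unfolding c_def n_def
      proof (rule hcontent_planes_le)
        fix P P' assume "P \<in> U i \<inter> E" "P' \<in> U i \<inter> E"
        thus "affine_dist P P' \<le> r i" using U(2)[of i] by (auto simp: diam_le_def)
      qed (use E U(3) r1 R m in auto)
      also have "\<dots> \<le> ennreal (C * r i powr t)"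
        by (intro ennreal_leI) (simp add: C_def mult_right_mono)
      finally show "hcontent dist (t + real k) (\<Union>(U i \<inter> E) \<inter> cball 0 R) \<le> ennreal (C * r i powr t)" .
    qed auto
    also have "\<dots> = ennreal (\<Sum>i. C * r i powr t)"
      by (rule suminf_ennreal2) (use U(4) C in auto)
    also have "(\<Sum>i. C * r i powr t) = C * (\<Sum>i. r i powr t)" by (rule suminf_mult[OF U(4)])
    also have "\<dots> \<le> C * (e / C)" using U(5) C by (intro mult_left_mono) auto
    also have "\<dots> = e" using C by simp
    finally show ?thesis by (simp add: ennreal_leI)
  qed
  hence "hcontent dist (t + real k) (\<Union>E \<inter> cball 0 R) \<le> 0" by (rule ennreal_le_epsilon)
  thus ?thesis by simp
qed

lemma hcontent_Union_zero:
  fixes E :: "(real ^ 'n) set set"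
  assumes E: "E \<subseteq> affine_subspaces k" and t: "0 < t" and z: "hcontent affine_dist t E = 0"
  shows "hcontent dist (t + real k) (\<Union>E) = 0"
proof -
  define I where "I = {(J :: 'n set, i :: nat). card J = k}"
  have "\<Union>E \<subseteq> (\<Union>(J, i)\<in>I. \<Union>(E \<inter> plane_chart J (real i)) \<inter> cball 0 (real i))"
  proof
    fix x assume "x \<in> \<Union>E"
    then obtain P where P: "P \<in> E" "x \<in> P" by blast
    obtain J m where J: "card J = k" "P \<in> plane_chart J m"
      using affine_subspace_in_chart[of P k] E P by blast
    define i where "i = nat \<lceil>max m (norm x)\<rceil>"
    have i: "m \<le> real i" "norm x \<le> real i" unfolding i_def by linarith+
    have "P \<in> plane_chart J (real i)" using plane_chart_mono[OF i(1)] J by blast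
    hence "x \<in> \<Union>(E \<inter> plane_chart J (real i)) \<inter> cball 0 (real i)" using P i by auto
    moreover have "(J, i) \<in> I" using J by (simp add: I_def)
    ultimately show "x \<in> (\<Union>(J, i)\<in>I. \<Union>(E \<inter> plane_chart J (real i)) \<inter> cball 0 (real i))" by blast
  qed
  hence "hcontent dist (t + real k) (\<Union>E)
      \<le> hcontent dist (t + real k) (\<Union>(J, i)\<in>I. \<Union>(E \<inter> plane_chart J (real i)) \<inter> cball 0 (real i))"
    by (rule hcontent_mono)
  also have "\<dots> = 0"
  proof (rule hcontent_UN_zero)
    fix p assume p: "p \<in> I"
    obtain J i where Ji: "p = (J, i)" by fastforce
    have "hcontent affine_dist t (E \<inter> plane_chart J (real i)) \<le> hcontent affine_dist t E"
      by (rule hcontent_mono) auto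
    hence "hcontent affine_dist t (E \<inter> plane_chart J (real i)) = 0" using z by simp
    thus "hcontent dist (t + real k) (case p of (J, i) \<Rightarrow> \<Union>(E \<inter> plane_chart J (real i)) \<inter> cball 0 (real i)) = 0"
      using E p t unfolding Ji prod.case
      by (intro hcontent_Union_chart_zero[where J = J and m = "real i"]) (auto simp: I_def)
  qed (rule countableI_type)
  finally show ?thesis by simp
qed

section \<open>Dyadic cells\<close>

definition cell :: "nat \<Rightarrow> real ^ 'n \<Rightarrow> 'n \<Rightarrow> int" where
  "cell l x = (\<lambda>j. \<lfloor>2^l * x $ j\<rfloor>)"

lemma cell_bounds: "of_int (cell l x j) \<le> 2^l * x $ j" "2^l * x $ j < of_int (cell l x j) + 1"
  unfolding cell_def by linarith+

lemma cell_close: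
  assumes "cell l x j = cell l y j"
  shows "\<bar>x $ j - y $ j\<bar> \<le> 1 / 2^l"
proof -
  have "\<bar>2^l * x $ j - 2^l * y $ j\<bar> \<le> 1"
    using cell_bounds[of l x j] cell_bounds[of l y j] assms by linarith
  hence "2^l * \<bar>x $ j - y $ j\<bar> \<le> 1" by (simp add: abs_mult flip: right_diff_distrib)
  thus ?thesis by (simp add: field_simps)
qed

lemma Suc_le_powr:
  assumes "e > 0"
  obtains c where "c > 0" "\<And>l::nat. real l + 1 \<le> c * 2 powr (e * real l)"
proof -
  define a where "a = e * ln 2"
  have a: "a > 0" using assms by (simp add: a_def)
  define c where "c = 1 + 1 / a"
  have "real l + 1 \<le> c * 2 powr (e * real l)" for l
  proof -
    have "1 + a * real l \<le> exp (a * real l)" by (rule exp_ge_add_one_self)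
    also have "\<dots> = 2 powr (e * real l)" by (simp add: powr_def a_def algebra_simps)
    finally have "c * (1 + a * real l) \<le> c * 2 powr (e * real l)"
      using a by (intro mult_left_mono) (auto simp: c_def)
    moreover have "real l + 1 \<le> c * (1 + a * real l)"
      using a by (simp add: c_def field_simps)
    ultimately show ?thesis by linarith
  qed
  moreover have "c > 0" using a by (simp add: c_def add_pos_pos)
  ultimately show ?thesis using that by blast
qed

lemma two_powr_neg: "2 powr (- a * real l) = (1 / 2^l) powr a"
  by (simp add: powr_divide powr_minus_divide powr_powr mult.commute flip: powr_realpow)

text \<open>
  Sort the sets of a cover of \<open>B\<close> by the size of their diameters, \<open>2\<^sup>-\<^sup>l\<^sup>-\<^sup>1 < r \<le> 2\<^sup>-\<^sup>l\<close>. The sum of the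
  \<open>r powr u\<close> is at most \<open>1\<close>, which limits the number of sets at level \<open>l\<close>, and each of them meets at
  most \<open>3 ^ CARD('n)\<close> cells of side \<open>2\<^sup>-\<^sup>l\<close>, the neighbours of the cell of any of its points. A cover
  with a small enough sum has no sets at the levels below \<open>l0\<close>.
\<close>

lemma dyadic_cell_cover:
  fixes B :: "(real ^ 'n) set"
  assumes z: "hcontent dist u B = 0" and u: "u > 0"
  obtains C :: "nat \<Rightarrow> ('n \<Rightarrow> int) set" where
    "\<And>l. finite (C l)" "\<And>l. real (card (C l)) \<le> 3 ^ CARD('n) * 2 powr (u * (real l + 1))"
    "\<And>x. x \<in> B \<Longrightarrow> \<exists>l\<ge>l0. cell l x \<in> C l"
proof -
  define e where "e = 2 powr (- u * real l0)"
  have e: "0 < e" "e \<le> 1" using u powr_mono[of "- u * real l0" 0 2] by (auto simp: e_def)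
  from hcontent_zero_cover[OF z u e(1)] obtain U r where
    U: "B \<subseteq> (\<Union>i. U i)" "\<And>i::nat. diam_le dist (U i) (r i)" "\<And>i. 0 < r i"
      "summable (\<lambda>i. r i powr u)" "(\<Sum>i. r i powr u) \<le> e" by metis
  define lev where "lev i = nat \<lfloor>- log 2 (r i)\<rfloor>" for i
  have rle: "r i \<le> 2 powr (- real l0)" for i
  proof (rule ccontr)
    assume "\<not> ?thesis"
    hence "(2 powr (- real l0)) powr u < r i powr u" using u by (intro powr_less_mono2) auto
    also have "\<dots> \<le> (\<Sum>i. r i powr u)" using sum_le_suminf[OF U(4), of "{i}"] by simp
    also have "\<dots> \<le> e" by (rule U(5))
    finally show False by (simp add: e_def powr_powr mult.commute)
  qed
  have ll0: "real l0 \<le> - log 2 (r i)" for i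
  proof -
    have "log 2 (r i) \<le> - real l0" using rle[of i] U(3)[of i] by (simp add: log_le_iff)
    thus ?thesis by linarith
  qed
  have lev0: "l0 \<le> lev i" for i using ll0[of i] unfolding lev_def by linarith
  have levle: "real (lev i) \<le> - log 2 (r i)" and levgt: "- log 2 (r i) < real (lev i) + 1" for i
    using ll0[of i] unfolding lev_def by linarith+
  have rup: "r i \<le> 1 / 2^lev i" for i
  proof -
    have "log 2 (r i) \<le> - real (lev i)" using levle[of i] by linarith
    hence "r i \<le> 2 powr (- real (lev i))" using U(3)[of i] by (simp add: log_le_iff)
    thus ?thesis by (simp add: powr_minus_divide powr_realpow)
  qed
  have rlo: "2 powr (- (u * (real (lev i) + 1))) \<le> r i powr u" for i
  proof -
    have "- (real (lev i) + 1) \<le> log 2 (r i)" using levgt[of i] by linarith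
    hence "2 powr (- (real (lev i) + 1)) \<le> r i" using U(3)[of i] by (simp add: le_log_iff)
    hence "(2 powr (- (real (lev i) + 1))) powr u \<le> r i powr u" using u by (intro powr_mono2) auto
    thus ?thesis by (simp add: powr_powr algebra_simps)
  qed
  define I where "I l = {i. lev i = l}" for l
  have bd: "real (card F) \<le> 2 powr (u * (real l + 1))" if F: "finite F" "F \<subseteq> I l" for F l
  proof -
    have "real (card F) * 2 powr (- (u * (real l + 1))) = (\<Sum>i\<in>F. 2 powr (- (u * (real l + 1))))" by simp
    also have "\<dots> \<le> (\<Sum>i\<in>F. r i powr u)"
      using F rlo by (intro sum_mono) (auto simp: I_def)
    also have "\<dots> \<le> (\<Sum>i. r i powr u)" using F by (intro sum_le_suminf U(4)) auto
    also have "\<dots> \<le> 1" using U(5) e by linarith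
    finally show ?thesis by (simp add: powr_minus_divide pos_divide_le_eq)
  qed
  have fin: "finite (I l)" for l
  proof -
    have "card F \<le> nat \<lfloor>2 powr (u * (real l + 1))\<rfloor>" if "F \<subseteq> I l" "finite F" for F
      using bd[OF that(2,1)] by linarith
    thus ?thesis using finite_if_finite_subsets_card_bdd by metis
  qed
  define N where "N = (PiE UNIV (\<lambda>_. {-1..1}) :: ('n \<Rightarrow> int) set)"
  have N: "finite N" "card N = 3 ^ CARD('n)"
    unfolding N_def by (auto simp: card_PiE intro: finite_PiE)
  define pick where "pick i = (SOME x. x \<in> U i)" for i
  define C where "C l = (\<Union>i\<in>I l. (\<lambda>v j. cell l (pick i) j + v j) ` N)" for l
  show ?thesis
  proof (rule that[of C])
    show "finite (C l)" for l unfolding C_def using fin N by auto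
    show "real (card (C l)) \<le> 3 ^ CARD('n) * 2 powr (u * (real l + 1))" for l
    proof -
      have "card (C l) \<le> (\<Sum>i\<in>I l. card ((\<lambda>v j. cell l (pick i) j + v j) ` N))"
        unfolding C_def by (rule card_UN_le[OF fin])
      also have "\<dots> \<le> (\<Sum>i\<in>I l. 3 ^ CARD('n))"
      proof (rule sum_mono)
        fix i show "card ((\<lambda>v j. cell l (pick i) j + v j) ` N) \<le> 3 ^ CARD('n)"
          using card_image_le[OF N(1), of "\<lambda>v j. cell l (pick i) j + v j"] N(2) by simp
      qed
      finally have "card (C l) \<le> card (I l) * 3 ^ CARD('n)" by simp
      hence "real (card (C l)) \<le> real (card (I l)) * 3 ^ CARD('n)"
        by (metis of_nat_le_iff of_nat_mult of_nat_numeral of_nat_power)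
      also have "\<dots> \<le> 2 powr (u * (real l + 1)) * 3 ^ CARD('n)"
        using bd[OF fin] by (intro mult_right_mono) auto
      finally show ?thesis by (simp add: mult.commute)
    qed
    fix x assume "x \<in> B"
    then obtain i where i: "x \<in> U i" using U(1) by blast
    hence p: "pick i \<in> U i" unfolding pick_def by (rule someI)
    define l where "l = lev i"
    define v where "v j = cell l x j - cell l (pick i) j" for j
    have "v j \<in> {-1..1}" for j
    proof -
      have "dist x (pick i) \<le> 1 / 2^l"
        using U(2)[of i] i p rup[of i] unfolding diam_le_def l_def by fastforce
      hence "\<bar>x $ j - pick i $ j\<bar> \<le> 1 / 2^l"
        using component_le_norm_cart[of "x - pick i" j] by (simp add: dist_norm)
      hence "2^l * \<bar>x $ j - pick i $ j\<bar> \<le> 1" by (simp add: field_simps)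
      hence "\<bar>2^l * x $ j - 2^l * pick i $ j\<bar> \<le> 1" by (simp add: abs_mult flip: right_diff_distrib)
      thus ?thesis unfolding v_def cell_def atLeastAtMost_iff by linarith
    qed
    hence "v \<in> N" by (auto simp: N_def)
    moreover have "cell l x = (\<lambda>j. cell l (pick i) j + v j)" by (simp add: v_def)
    ultimately have "cell l x \<in> C l" unfolding C_def I_def l_def by blast
    thus "\<exists>l\<ge>l0. cell l x \<in> C l" using lev0[of i] unfolding l_def by blast
  qed
qed

lemma hcontent_levels_le:
  assumes "Y \<subseteq> (\<Union>l\<in>{l0..}. Z l)" and e: "e > 0" and K: "K \<ge> 0"
    and "\<And>l. l \<ge> l0 \<Longrightarrow> hcontent d t (Z l) \<le> ennreal (K * 2 powr (- e * real l))"
  shows "hcontent d t Y \<le> ennreal (K * 2 powr (- e * real l0) / (1 - 2 powr (- e)))"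
proof -
  define q where "q = 2 powr (- e)"
  have q: "0 < q" "q < 1" using powr_less_mono[of "- e" 0 2] e by (auto simp: q_def)
  have q_pow: "2 powr (- e * real l) = q ^ l" for l
    by (simp add: q_def powr_powr flip: powr_realpow)
  have "hcontent d t Y \<le> hcontent d t (\<Union>i. Z (l0 + i))"
  proof (rule hcontent_mono, rule subsetI)
    fix x assume "x \<in> Y"
    then obtain l where "l \<ge> l0" "x \<in> Z l" using assms(1) by blast
    thus "x \<in> (\<Union>i. Z (l0 + i))" by (intro UN_I[of "l - l0"]) auto
  qed
  also have "\<dots> \<le> (\<Sum>i. hcontent d t (Z (l0 + i)))" by (rule hcontent_UN_le)
  also have "\<dots> \<le> (\<Sum>i. ennreal (K * q ^ l0 * q ^ i))"
  proof (intro suminf_le allI)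
    fix i show "hcontent d t (Z (l0 + i)) \<le> ennreal (K * q ^ l0 * q ^ i)"
      using assms(4)[of "l0 + i"] unfolding q_pow by (simp add: power_add mult.assoc)
  qed auto
  also have "\<dots> = ennreal (K * q ^ l0 * (1 / (1 - q)))"
    using q K by (intro suminf_ennreal_eq sums_mult geometric_sums) auto
  finally show ?thesis unfolding q_pow q_def by simp
qed

lemma tail_small:
  assumes "e > 0" "c > 0" "K \<ge> 0"
  obtains l0 :: nat where "K * 2 powr (- e * real l0) / (1 - 2 powr (- e)) < c"
proof -
  have "2 powr (- e) < 1" using powr_less_mono[of "- e" 0 2] assms by auto
  moreover have "(\<lambda>l. (2 powr (- e)) ^ l) \<longlonglongrightarrow> 0"
    using calculation by (intro LIMSEQ_power_zero) auto
  hence "(\<lambda>l. K * 2 powr (- e * real l) / (1 - 2 powr (- e))) \<longlonglongrightarrow> K * 0 / (1 - 2 powr (- e))"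
    using calculation by (intro tendsto_intros) (auto simp: powr_powr simp flip: powr_realpow)
  hence "eventually (\<lambda>l. K * 2 powr (- e * real l) / (1 - 2 powr (- e)) < c) sequentially"
    using assms by (intro order_tendstoD(2)[where a = c]) auto
  then obtain l0 where "K * 2 powr (- e * real l0) / (1 - 2 powr (- e)) < c"
    unfolding eventually_sequentially by blast
  thus ?thesis by (rule that)
qed

text \<open>
  Only the cells of the coordinates in \<open>J\<close> are counted. This suffices because points of \<open>P\<close> that
  agree in these coordinates up to \<open>2\<^sup>-\<^sup>l\<close> are \<open>O(2\<^sup>-\<^sup>l)\<close>-close, and it makes the number of cells that
  two planes share a question about lattice points in \<open>k\<close> dimensions.
\<close>

lemma hcontent_slice_le:
  fixes Y :: "(real ^ 'n) set" and m :: real and a :: real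
  defines "n \<equiv> real CARD('n)"
  assumes P: "P \<in> plane_chart J m" "Y \<subseteq> P" and m: "0 \<le> m"
    and fin: "finite ((\<lambda>x. restrict (cell l x) J) ` Y)"
    and card: "real (card ((\<lambda>x. restrict (cell l x) J) ` Y)) \<le> T"
  shows "hcontent dist a Y \<le> ennreal ((n * (1 + n * m)) powr a * (T * 2 powr (- a * real l)))"
proof -
  let ?W = "(\<lambda>x. restrict (cell l x) J) ` Y"
  define c where "c = n * (1 + n * m)"
  have c: "0 \<le> c" using m by (simp add: c_def n_def)
  obtain A b where Ab: "P = graph_plane J A b" "\<And>i j. \<bar>A $ i $ j\<bar> \<le> m"
    using P(1) by (auto simp: plane_chart_def)
  have "hcontent dist a Y \<le> ennreal (\<Sum>w\<in>?W. (c * (1 / 2^l)) powr a)"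
  proof (rule hcontent_le_finite[where U = "\<lambda>w. {x\<in>Y. restrict (cell l x) J = w}"])
    fix w
    show "diam_le dist {x\<in>Y. restrict (cell l x) J = w} (c * (1 / 2^l))"
      unfolding diam_le_def
    proof (intro conjI ballI)
      fix x y assume "x \<in> {x\<in>Y. restrict (cell l x) J = w}" "y \<in> {x\<in>Y. restrict (cell l x) J = w}"
      hence xy: "x \<in> Y" "y \<in> Y" "restrict (cell l x) J = restrict (cell l y) J" by auto
      have "norm (x - y) \<le> real CARD('n) * ((1 + real CARD('n) * m) * (1 / 2^l))"
      proof (rule graph_plane_lipschitz[OF _ _ Ab(2)])
        show "x \<in> graph_plane J A b" "y \<in> graph_plane J A b" using xy P Ab by auto
        show "\<bar>x $ j - y $ j\<bar> \<le> 1 / 2^l" if "j \<in> J" for j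
          using fun_cong[OF xy(3), of j] that by (intro cell_close) simp
      qed auto
      thus "dist x y \<le> c * (1 / 2^l)" by (simp add: c_def n_def dist_norm)
    qed (use c in auto)
  qed (use fin in auto)
  also have "(\<Sum>w\<in>?W. (c * (1 / 2^l)) powr a) = c powr a * (real (card ?W) * 2 powr (- a * real l))"
    unfolding two_powr_neg powr_mult by simp
  also have "\<dots> \<le> c powr a * (T * 2 powr (- a * real l))"
    using card by (intro mult_left_mono mult_right_mono) auto
  finally show ?thesis unfolding c_def by (simp add: ennreal_leI)
qed

section \<open>Cells common to two planes\<close>

lemma card_le_fibres:
  assumes "finite F" "f ` W \<subseteq> F" "finite W" "\<And>y. y \<in> F \<Longrightarrow> real (card {w\<in>W. f w = y}) \<le> L"
  shows "real (card W) \<le> real (card F) * L"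
proof -
  have "W = (\<Union>y\<in>F. {w\<in>W. f w = y})" using assms(2) by auto
  hence "card W \<le> (\<Sum>y\<in>F. card {w\<in>W. f w = y})" using card_UN_le[OF assms(1)] by metis
  hence "real (card W) \<le> (\<Sum>y\<in>F. real (card {w\<in>W. f w = y}))"
    by (metis of_nat_le_iff of_nat_sum)
  also have "\<dots> \<le> (\<Sum>y\<in>F. L)" using assms(4) by (intro sum_mono)
  finally show ?thesis by simp
qed

lemma card_int_diam_le:
  fixes T :: "int set"
  assumes "finite T" "\<And>s t. s \<in> T \<Longrightarrow> t \<in> T \<Longrightarrow> real_of_int (s - t) \<le> L" "0 \<le> L"
  shows "real (card T) \<le> L + 1"
proof (cases "T = {}")
  case False
  have mM: "Min T \<in> T" "Max T \<in> T" "Min T \<le> Max T" using False assms(1) by auto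
  have "card T \<le> card {Min T..Max T}" using assms(1) by (intro card_mono) auto
  hence "real (card T) \<le> real_of_int (Max T - Min T) + 1" using mM(3) by simp
  thus ?thesis using assms(2)[OF mM(2,1)] by linarith
qed (use assms in auto)

text \<open>
  Once the coordinates other than \<open>j\<close> are fixed, the strip confines the \<open>j\<close>-th coordinate to an
  interval of length \<open>2 c / a\<close>.
\<close>

lemma card_lattice_strip_le:
  fixes W :: "('n \<Rightarrow> int) set" and \<alpha> :: "'n \<Rightarrow> real"
  assumes J: "finite J" "j \<in> J" and W: "W \<subseteq> PiE J (\<lambda>_. {-M..M})" and M: "0 \<le> M"
    and a: "0 < a" "a \<le> \<bar>\<alpha> j\<bar>" and c: "0 \<le> c"
    and strip: "\<And>w. w \<in> W \<Longrightarrow> \<bar>\<beta> + (\<Sum>i\<in>J. \<alpha> i * of_int (w i))\<bar> \<le> c"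
  shows "real (card W) \<le> (2 * of_int M + 1) ^ (card J - 1) * (2 * c / a + 1)"
proof -
  let ?F = "PiE (J - {j}) (\<lambda>_. {-M..M})"
  define f where "f w = restrict w (J - {j})" for w :: "'n \<Rightarrow> int"
  have finW: "finite W" by (rule finite_subset[OF W]) (use J in \<open>auto intro!: finite_PiE\<close>)
  have "real (card W) \<le> real (card ?F) * (2 * c / a + 1)"
  proof (rule card_le_fibres[where f = f])
    show "finite ?F" using J by (auto intro!: finite_PiE)
    show "f ` W \<subseteq> ?F"
    proof (rule image_subsetI)
      fix w assume "w \<in> W"
      hence "\<And>i. i \<in> J \<Longrightarrow> w i \<in> {-M..M}" using W by (auto dest!: subsetD PiE_mem)
      thus "f w \<in> ?F" unfolding f_def by (auto simp: restrict_PiE_iff)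
    qed
    fix y assume "y \<in> ?F"
    let ?G = "{w\<in>W. f w = y}"
    have agree: "w i = w' i" if "w \<in> ?G" "w' \<in> ?G" "i \<noteq> j" for w w' i
    proof (cases "i \<in> J")
      case True
      have "f w i = f w' i" using that by simp
      thus ?thesis using True that by (simp add: f_def)
    next
      case False
      have "w \<in> PiE J (\<lambda>_. {-M..M})" "w' \<in> PiE J (\<lambda>_. {-M..M})" using that W by blast+
      thus ?thesis using PiE_arb[OF _ False] by metis
    qed
    have "inj_on (\<lambda>w. w j) ?G"
    proof (rule inj_onI)
      fix w w' assume w: "w \<in> ?G" "w' \<in> ?G" "w j = w' j"
      show "w = w'"
      proof
        fix i show "w i = w' i" by (cases "i = j") (use w agree[OF w(1,2), of i] in auto)
      qed
    qed
    hence "card ?G = card ((\<lambda>w. w j) ` ?G)" by (simp add: card_image)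
    also have "real \<dots> \<le> 2 * c / a + 1"
    proof (rule card_int_diam_le)
      fix s t assume "s \<in> (\<lambda>w. w j) ` ?G" "t \<in> (\<lambda>w. w j) ` ?G"
      then obtain w w' where w: "w \<in> ?G" "w' \<in> ?G" "s = w j" "t = w' j" by blast
      have "(\<Sum>i\<in>J. \<alpha> i * of_int (w i)) - (\<Sum>i\<in>J. \<alpha> i * of_int (w' i))
          = (\<Sum>i\<in>J. if i = j then \<alpha> j * of_int (s - t) else 0)"
        unfolding sum_subtractf[symmetric]
        using agree[OF w(1,2)] w by (intro sum.cong) (auto simp: algebra_simps)
      also have "\<dots> = \<alpha> j * of_int (s - t)" using J by simp
      finally have "\<bar>\<alpha> j * of_int (s - t)\<bar> \<le> 2 * c"
        using strip[of w] strip[of w'] w by auto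
      hence "\<bar>\<alpha> j\<bar> * \<bar>of_int (s - t)\<bar> \<le> 2 * c" by (simp only: abs_mult)
      hence "a * \<bar>of_int (s - t)\<bar> \<le> 2 * c" using a by (meson abs_ge_zero mult_right_mono order_trans)
      hence "\<bar>real_of_int (s - t)\<bar> \<le> 2 * c / a" using a by (simp add: field_simps)
      thus "real_of_int (s - t) \<le> 2 * c / a" by linarith
    qed (use finW a c in auto)
    finally show "real (card ?G) \<le> 2 * c / a + 1" .
  qed (rule finW)
  also have "real (card ?F) = (2 * of_int M + 1) ^ (card J - 1)"
    using J M by (simp add: card_PiE algebra_simps)
  finally show ?thesis .
qed

text \<open>
  Subtract the equations of the two planes for the coordinate \<open>i\<close>, scaled by \<open>2\<^sup>l\<close>. Replacing
  \<open>2\<^sup>l x\<close> and \<open>2\<^sup>l x'\<close> by the integer vector \<open>z\<close> changes each coordinate by at most \<open>1\<close>.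
\<close>

lemma graph_plane_difference_on_cell:
  fixes x x' :: "real ^ 'n"
  defines "n \<equiv> real CARD('n)"
  assumes x: "x \<in> graph_plane J A b" and x': "x' \<in> graph_plane J A' b'"
    and A: "\<And>i j. \<bar>A $ i $ j\<bar> \<le> m" "\<And>i j. \<bar>A' $ i $ j\<bar> \<le> m"
    and c: "cell l x = z" "cell l x' = z" and i: "i \<notin> J"
  shows "\<bar>2^l * (b $ i - b' $ i) + (\<Sum>j\<in>J. (A $ i $ j - A' $ i $ j) * of_int (z j))\<bar> \<le> 1 + 2 * n * m"
proof -
  have m: "0 \<le> m" using A(1) abs_ge_zero order_trans by blast
  have cx: "\<bar>2^l * x $ j - of_int (z j)\<bar> \<le> 1" "\<bar>2^l * x' $ j - of_int (z j)\<bar> \<le> 1" for j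
    using cell_bounds[of l x j] cell_bounds[of l x' j] c by auto
  have e1: "\<bar>\<Sum>j\<in>J. A $ i $ j * (2^l * x $ j - of_int (z j))\<bar> \<le> n * m * 1"
    unfolding n_def using A cx m by (intro abs_sum_prod_bound) auto
  have e2: "\<bar>\<Sum>j\<in>J. A' $ i $ j * (2^l * x' $ j - of_int (z j))\<bar> \<le> n * m * 1"
    unfolding n_def using A cx m by (intro abs_sum_prod_bound) auto
  have "2^l * x $ i = 2^l * b $ i + (\<Sum>j\<in>J. A $ i $ j * (2^l * x $ j))"
    using x i by (simp add: graph_plane_def algebra_simps sum_distrib_left)
  moreover have "2^l * x' $ i = 2^l * b' $ i + (\<Sum>j\<in>J. A' $ i $ j * (2^l * x' $ j))"
    using x' i by (simp add: graph_plane_def algebra_simps sum_distrib_left)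
  moreover have "\<bar>2^l * x $ i - 2^l * x' $ i\<bar> \<le> 1"
    using cell_bounds[of l x i] cell_bounds[of l x' i] c unfolding abs_le_iff by auto
  ultimately show ?thesis using e1 e2
    by (simp add: algebra_simps sum_subtractf sum.distrib)
qed

text \<open>
  Common cells project to lattice points satisfying \<open>|2\<^sup>l \<beta>\<^sub>i + \<Sum> \<alpha>\<^sub>i\<^sub>j z\<^sub>j| \<le> O(1)\<close>, where \<open>\<alpha>\<close>, \<open>\<beta>\<close> are the
  differences of the coefficients. One of these is at least of the order of \<open>affine_dist P P'\<close>. If
  some \<open>\<alpha>\<^sub>i\<^sub>j\<close> is, the lattice points lie in a thin strip. Otherwise some \<open>\<beta>\<^sub>i\<close> dominates, and a common
  cell can only exist if the distance is \<open>O(2\<^sup>-\<^sup>l)\<close>; then the trivial bound is good enough.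
\<close>

lemma card_common_cells_le:
  fixes J :: "'n::finite set"
  assumes J: "card J = k" "1 \<le> k" and m: "0 \<le> m" and R: "0 \<le> R"
  obtains K where "K > 0"
    "\<And>l Z P P'. P \<in> plane_chart J m \<Longrightarrow> P' \<in> plane_chart J m \<Longrightarrow> inj_on (\<lambda>z. restrict z J) Z \<Longrightarrow>
       (\<And>z. z \<in> Z \<Longrightarrow> (\<exists>x\<in>P \<inter> cball 0 R. cell l x = z) \<and> (\<exists>x\<in>P' \<inter> cball 0 R. cell l x = z)) \<Longrightarrow>
       real (card Z) \<le> K * 2^(l * k) \<and>
       (0 < affine_dist P P' \<longrightarrow> real (card Z) \<le> K * 2^(l * (k - 1)) / affine_dist P P')"
proof -
  define n where "n = real CARD('n)"
  have n1: "1 \<le> n" unfolding n_def by (simp add: Suc_leI)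
  define c2 where "c2 = 2 * n\<^sup>2 + n + 2 * n^3 * m"
  have c2: "0 < c2" using n1 m unfolding c2_def by (intro add_pos_nonneg) auto
  define c1 where "c1 = 1 + 2 * n * m"
  have c1: "1 \<le> c1" using n1 m by (simp add: c1_def)
  define g where "g = 2 * n * (R + 1)"
  have g: "1 \<le> g" unfolding g_def using n1 R by (smt (verit) mult_le_cancel_left1 mult_mono)
  define K1 where "K1 = (2 * R + 5) ^ k"
  define K2 where "K2 = K1 * (2 * c1 * (2 * c2))"
  define K3 where "K3 = (2 * R + 5) ^ (k - 1) * ((2 * c1 + 2 * m) * (g * (2 * c2)))"
  define K where "K = K1 + K2 + K3"
  have K0: "0 < K1" "0 \<le> K2" "0 \<le> K3"
    using R c1 c2 g m by (auto simp: K1_def K2_def K3_def)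
  show ?thesis
  proof (rule that[of K])
    show "0 < K" using K0 by (simp add: K_def)
    fix l Z and P P' :: "(real ^ 'n) set"
    assume P: "P \<in> plane_chart J m" "P' \<in> plane_chart J m" and inj: "inj_on (\<lambda>z. restrict z J) Z"
      and Z: "\<And>z. z \<in> Z \<Longrightarrow> (\<exists>x\<in>P \<inter> cball 0 R. cell l x = z) \<and> (\<exists>x\<in>P' \<inter> cball 0 R. cell l x = z)"
    define W where "W = (\<lambda>z. restrict z J) ` Z"
    have cardW: "card Z = card W" unfolding W_def using card_image[OF inj] by simp
    define M where "M = \<lceil>2^l * R\<rceil> + 1"
    have M0: "0 \<le> M"
    proof -
      have "0 \<le> 2^l * R" using R by simp
      thus ?thesis unfolding M_def by linarith
    qed
    have Zb: "\<bar>real_of_int (z j)\<bar> \<le> 2^l * R + 1" if "z \<in> Z" for z j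
    proof -
      obtain x where x: "x \<in> cball 0 R" "cell l x = z" using Z \<open>z \<in> Z\<close> by blast
      have "\<bar>x $ j\<bar> \<le> R" using component_le_norm_cart[of x j] x by auto
      hence "\<bar>2^l * x $ j\<bar> \<le> 2^l * R" by (simp add: abs_mult)
      thus ?thesis using cell_bounds[of l x j] x by auto
    qed
    have W: "W \<subseteq> PiE J (\<lambda>_. {-M..M})"
    proof -
      have "z j \<in> {-M..M}" if "z \<in> Z" for z j
        using Zb[OF that, of j] unfolding M_def atLeastAtMost_iff by linarith
      thus ?thesis unfolding W_def by (auto simp: restrict_PiE_iff)
    qed
    have MR: "2 * real_of_int M + 1 \<le> (2 * R + 5) * 2^l"
    proof -
      have "real_of_int M \<le> 2^l * R + 2" unfolding M_def by linarith
      moreover have "(1::real) \<le> 2^l" by simp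
      ultimately have "2 * real_of_int M + 1 \<le> 2 * (2^l * R) + 5 * 2^l" by linarith
      thus ?thesis by (simp add: algebra_simps)
    qed
    have Mpow: "(2 * real_of_int M + 1) ^ q \<le> (2 * R + 5) ^ q * 2 ^ (l * q)" for q
    proof -
      have "(2 * real_of_int M + 1) ^ q \<le> ((2 * R + 5) * 2^l) ^ q"
        using MR M0 by (intro power_mono) auto
      thus ?thesis by (simp add: power_mult_distrib power_mult)
    qed
    have triv: "real (card Z) \<le> K1 * 2 ^ (l * k)"
    proof -
      have "card W \<le> card (PiE J (\<lambda>_. {-M..M}))" by (intro card_mono W finite_PiE) auto
      also have "\<dots> = nat (2 * M + 1) ^ k" using J by (simp add: card_PiE algebra_simps)
      finally have "real (card W) \<le> real (nat (2 * M + 1) ^ k)" by (rule of_nat_mono)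
      also have "\<dots> = (2 * real_of_int M + 1) ^ k" using M0 by simp
      finally have "real (card W) \<le> (2 * real_of_int M + 1) ^ k" .
      thus ?thesis using Mpow[of k] unfolding cardW K1_def by linarith
    qed
    have "real (card Z) \<le> K * 2^(l * (k - 1)) / affine_dist P P'" if d: "0 < affine_dist P P'"
    proof (cases "Z = {}")
      case False
      obtain A b where Ab: "P = graph_plane J A b" "\<And>j. j \<in> J \<Longrightarrow> b $ j = 0"
        "\<And>i j. \<bar>A $ i $ j\<bar> \<le> m" "\<And>i. \<bar>b $ i\<bar> \<le> m" using P(1) unfolding plane_chart_def by blast
      obtain A' b' where Ab': "P' = graph_plane J A' b'" "\<And>j. j \<in> J \<Longrightarrow> b' $ j = 0"
        "\<And>i j. \<bar>A' $ i $ j\<bar> \<le> m" "\<And>i. \<bar>b' $ i\<bar> \<le> m" using P(2) unfolding plane_chart_def by blast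
      have strip: "\<bar>2^l * (b $ i - b' $ i) + (\<Sum>j\<in>J. (A $ i $ j - A' $ i $ j) * of_int (z j))\<bar> \<le> c1"
        if "z \<in> Z" "i \<notin> J" for z i
      proof -
        obtain x x' where "x \<in> P" "cell l x = z" "x' \<in> P'" "cell l x' = z" using Z \<open>z \<in> Z\<close> by blast
        thus ?thesis unfolding c1_def n_def
          using graph_plane_difference_on_cell[of x J A b x' A' b' m l z i] Ab Ab' \<open>i \<notin> J\<close> by blast
      qed
      \<comment> \<open>If all coefficients differed by at most \<open>D\<close>, the distance would be at most half of itself.
        The smaller threshold \<open>\<eta>\<close> for the slopes bounds their total effect on the ball by \<open>D / 2\<close>.\<close>
      define D where "D = affine_dist P P' / (2 * c2)"
      have D: "0 < D" "affine_dist P P' = 2 * c2 * D" using d c2 by (auto simp: D_def)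
      define \<eta> where "\<eta> = D / g"
      have \<eta>: "0 < \<eta>" "\<eta> \<le> D" "D = g * \<eta>" using D g by (auto simp: \<eta>_def field_simps)
      consider (slope) i j where "i \<notin> J" "j \<in> J" "\<eta> < \<bar>A $ i $ j - A' $ i $ j\<bar>"
        | (flat) "\<And>i j. i \<notin> J \<Longrightarrow> j \<in> J \<Longrightarrow> \<bar>A $ i $ j - A' $ i $ j\<bar> \<le> \<eta>" by force
      thus ?thesis
      proof cases
        case slope
        define \<alpha> where "\<alpha> j' = A $ i $ j' - A' $ i $ j'" for j'
        have "real (card W) \<le> (2 * of_int M + 1) ^ (card J - 1) * (2 * c1 / \<eta> + 1)"
        proof (rule card_lattice_strip_le[where j = j and \<alpha> = \<alpha> and \<beta> = "2^l * (b $ i - b' $ i)"])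
          fix w assume "w \<in> W"
          then obtain z where z: "z \<in> Z" "w = restrict z J" unfolding W_def by blast
          have "(\<Sum>i\<in>J. \<alpha> i * of_int (w i)) = (\<Sum>i\<in>J. \<alpha> i * of_int (z i))"
            using z by (intro sum.cong) auto
          thus "\<bar>2^l * (b $ i - b' $ i) + (\<Sum>i\<in>J. \<alpha> i * of_int (w i))\<bar> \<le> c1"
            using strip[OF z(1) slope(1)] by (simp add: \<alpha>_def)
        qed (use slope \<eta> W M0 c1 in \<open>auto simp: \<alpha>_def\<close>)
        also have "\<dots> \<le> ((2 * R + 5) ^ (k - 1) * 2 ^ (l * (k - 1))) * ((2 * c1 + 2 * m) / \<eta>)"
        proof (rule mult_mono)
          show "(2 * real_of_int M + 1) ^ (card J - 1) \<le> (2 * R + 5) ^ (k - 1) * 2 ^ (l * (k - 1))"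
            using Mpow[of "k - 1"] J by simp
          have "\<eta> \<le> 2 * m" using slope(3) Ab(3)[of i j] Ab'(3)[of i j] by linarith
          hence "1 \<le> 2 * m / \<eta>" using \<eta> by simp
          thus "2 * c1 / \<eta> + 1 \<le> (2 * c1 + 2 * m) / \<eta>" by (simp add: add_divide_distrib)
        qed (use R c1 \<eta> in auto)
        also have "\<dots> = K3 * 2 ^ (l * (k - 1)) / affine_dist P P'"
          unfolding D(2) \<eta>(3) K3_def using \<eta>(1) g c2 by simp
        also have "\<dots> \<le> K * 2 ^ (l * (k - 1)) / affine_dist P P'"
          using d K0 by (intro divide_right_mono mult_right_mono) (auto simp: K_def)
        finally show ?thesis unfolding cardW .
      next
        case flat
        have "\<exists>i. i \<notin> J \<and> D < \<bar>b $ i - b' $ i\<bar>"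
        proof (rule ccontr)
          assume no: "\<not> ?thesis"
          have "affine_dist P P' \<le> c2 * D"
            unfolding Ab(1) Ab'(1) c2_def n_def
          proof (rule affine_dist_graph_plane_le)
            fix i show "\<bar>b $ i - b' $ i\<bar> \<le> D" using no Ab(2) Ab'(2) D by (cases "i \<in> J") auto
            fix j show "\<bar>A $ i $ j - A' $ i $ j\<bar> \<le> D" if "i \<notin> J" "j \<in> J"
              using flat[OF that] \<eta>(2) by linarith
          qed (use Ab(2) Ab'(2,4) in auto)
          thus False using D c2 by (simp add: mult_less_cancel_right)
        qed
        then obtain i where i: "i \<notin> J" "D < \<bar>b $ i - b' $ i\<bar>" by blast
        obtain z where z: "z \<in> Z" using False by blast
        have "\<bar>\<Sum>j\<in>J. (A $ i $ j - A' $ i $ j) * of_int (z j)\<bar> \<le> n * \<eta> * (2^l * (R + 1))"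
          unfolding n_def
        proof (rule abs_sum_prod_bound)
          fix j
          have "(1::real) \<le> 2^l" by simp
          hence "\<bar>real_of_int (z j)\<bar> \<le> 2^l * R + 2^l" using Zb[OF z, of j] by linarith
          thus "\<bar>real_of_int (z j)\<bar> \<le> 2^l * (R + 1)" by (simp add: algebra_simps)
        qed (use flat[OF i(1)] \<eta> R in auto)
        also have "\<dots> = 2^l * (D / 2)" unfolding \<eta>(3) g_def by simp
        finally have "\<bar>\<Sum>j\<in>J. (A $ i $ j - A' $ i $ j) * of_int (z j)\<bar> \<le> 2^l * (D / 2)" .
        moreover have "2^l * D \<le> \<bar>2^l * (b $ i - b' $ i)\<bar>" using i(2) by (simp add: abs_mult)
        ultimately have "2^l * D \<le> 2^l * (D / 2) + c1" using strip[OF z i(1)] by linarith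
        hence "2^l \<le> 2 * c1 / D" using D(1) by (simp add: field_simps)
        moreover have "l * k = l * (k - 1) + l" using J(2) by (simp add: algebra_simps)
        hence "(2::real) ^ (l * k) = 2 ^ (l * (k - 1)) * 2 ^ l" by (simp add: power_add)
        ultimately have "real (card Z) \<le> K1 * (2 ^ (l * (k - 1)) * (2 * c1 / D))"
          using triv K0 by (smt (verit) mult_left_mono zero_le_power)
        also have "\<dots> = K2 * 2 ^ (l * (k - 1)) / affine_dist P P'"
          unfolding D(2) K2_def using D(1) c2 by simp
        also have "\<dots> \<le> K * 2 ^ (l * (k - 1)) / affine_dist P P'"
          using d K0 by (intro divide_right_mono mult_right_mono) (auto simp: K_def)
        finally show ?thesis .
      qed
    qed (use K0 d in \<open>simp add: K_def\<close>)
    moreover have "real (card Z) \<le> K * 2 ^ (l * k)"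
      using triv K0 by (smt (verit) K_def mult_right_mono zero_le_power)
    ultimately show "real (card Z) \<le> K * 2^(l * k) \<and>
       (0 < affine_dist P P' \<longrightarrow> real (card Z) \<le> K * 2^(l * (k - 1)) / affine_dist P P')" by blast
  qed
qed

section \<open>The lower bound by an \<open>L\<^sup>2\<close> argument\<close>

text \<open>
  Here \<open>C\<close> is the set of all cells and \<open>X P\<close> the cells that \<open>P\<close> meets. If \<open>d P Q\<close> is about
  \<open>\<Lambda> / 2\<^sup>j\<close>, the planes share \<open>O(2\<^sup>(\<^sup>k\<^sup>-\<^sup>1\<^sup>)\<^sup>l 2\<^sup>j)\<close> cells, and at most \<open>2\<^sup>s\<^sup>(\<^sup>l\<^sup>-\<^sup>j\<^sup>) \<le> 2\<^sup>l\<^sup>-\<^sup>j\<close> planes \<open>Q\<close> are that close.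
  Thus each of the \<open>l + 1\<close> values of \<open>j\<close> contributes \<open>O(2\<^sup>k\<^sup>l)\<close> to the sum over \<open>Q\<close>; this is where
  \<open>s \<le> 1\<close> enters.
\<close>

lemma card_planes_at_scale:
  fixes J :: "'n::finite set"
  assumes J: "card J = k" "1 \<le> k" and m: "0 \<le> m" and R: "0 \<le> R"
    and L: "0 < \<Lambda>" and K2: "0 < K2" and s: "s \<le> 1"
  obtains K where "K > 0"
    "\<And>l S d C X T. finite S \<Longrightarrow> S \<subseteq> plane_chart J m \<Longrightarrow>
      (\<And>P Q. P \<in> S \<Longrightarrow> Q \<in> S \<Longrightarrow> d P Q \<le> \<Lambda> \<and> d P Q \<le> K2 * affine_dist P Q) \<Longrightarrow>
      (\<And>P j. P \<in> S \<Longrightarrow> j \<le> l \<Longrightarrow>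
         real (card {Q\<in>S. d P Q \<le> \<Lambda> / 2^j}) \<le> 2 powr (s * (real l - real j))) \<Longrightarrow>
      finite C \<Longrightarrow>
      (\<And>P. P \<in> S \<Longrightarrow> X P \<subseteq> C \<and> inj_on (\<lambda>z. restrict z J) (X P) \<and>
         (\<forall>z\<in>X P. \<exists>x\<in>P \<inter> cball 0 R. cell l x = z) \<and> T \<le> real (card (X P))) \<Longrightarrow>
      0 \<le> T \<Longrightarrow>
      real (card S) * T\<^sup>2 \<le> K * (real l + 1) * 2^(l * k) * real (card C)"
proof -
  obtain K0 where K0: "K0 > 0"
    "\<And>l Z P P'. P \<in> plane_chart J m \<Longrightarrow> P' \<in> plane_chart J m \<Longrightarrow> inj_on (\<lambda>z. restrict z J) Z \<Longrightarrow>
       (\<And>z. z \<in> Z \<Longrightarrow> (\<exists>x\<in>P \<inter> cball 0 R. cell l x = z) \<and> (\<exists>x\<in>P' \<inter> cball 0 R. cell l x = z)) \<Longrightarrow>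
       real (card Z) \<le> K0 * 2^(l * k) \<and>
       (0 < affine_dist P P' \<longrightarrow> real (card Z) \<le> K0 * 2^(l * (k - 1)) / affine_dist P P')"
    by (rule card_common_cells_le[OF J m R]) blast
  define K where "K = K0 + 2 * K0 * K2 / \<Lambda>"
  have K: "0 < K" using K0(1) K2 L by (simp add: K_def add_pos_pos)
  show ?thesis
  proof (rule that[OF K])
    fix l :: nat and S :: "(real ^ 'n) set set" and d and C :: "('n \<Rightarrow> int) set" and X and T :: real
    assume fin: "finite S" and chart: "S \<subseteq> plane_chart J m"
      and d: "\<And>P Q. P \<in> S \<Longrightarrow> Q \<in> S \<Longrightarrow> d P Q \<le> \<Lambda> \<and> d P Q \<le> K2 * affine_dist P Q"
      and frost: "\<And>P j. P \<in> S \<Longrightarrow> j \<le> l \<Longrightarrow>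
         real (card {Q\<in>S. d P Q \<le> \<Lambda> / 2^j}) \<le> 2 powr (s * (real l - real j))"
      and finC: "finite C"
      and X: "\<And>P. P \<in> S \<Longrightarrow> X P \<subseteq> C \<and> inj_on (\<lambda>z. restrict z J) (X P) \<and>
         (\<forall>z\<in>X P. \<exists>x\<in>P \<inter> cball 0 R. cell l x = z) \<and> T \<le> real (card (X P))"
      and T: "0 \<le> T"
    define w where "w j = K * (2 ^ (l * (k - 1)) * 2 ^ j)" for j :: nat
    have w0: "0 \<le> w j" for j using K by (simp add: w_def)
    have lk: "l * k = l * (k - 1) + l" using J(2) by (cases k) auto
    have pair: "real (card (X P \<inter> X Q)) \<le> (\<Sum>j\<le>l. of_bool (d P Q \<le> \<Lambda> / 2^j) * w j)"
      if PQ: "P \<in> S" "Q \<in> S" for P Q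
    proof -
      have inj: "inj_on (\<lambda>z. restrict z J) (X P \<inter> X Q)"
        using X[OF PQ(1)] by (auto intro: inj_on_subset)
      have both: "(\<exists>x\<in>P \<inter> cball 0 R. cell l x = z) \<and> (\<exists>x\<in>Q \<inter> cball 0 R. cell l x = z)"
        if "z \<in> X P \<inter> X Q" for z using X[OF PQ(1)] X[OF PQ(2)] that by blast
      have b: "real (card (X P \<inter> X Q)) \<le> K0 * 2^(l * k)"
        "0 < affine_dist P Q \<Longrightarrow> real (card (X P \<inter> X Q)) \<le> K0 * 2^(l * (k - 1)) / affine_dist P Q"
        using K0(2)[OF subsetD[OF chart PQ(1)] subsetD[OF chart PQ(2)] inj both] by blast+
      define j where "j = Max {j. j \<le> l \<and> d P Q \<le> \<Lambda> / 2^j}"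
      have finj: "finite {j. j \<le> l \<and> d P Q \<le> \<Lambda> / 2^j}" by simp
      have "0 \<in> {j. j \<le> l \<and> d P Q \<le> \<Lambda> / 2^j}" using d[OF PQ] by simp
      hence j: "j \<le> l" "d P Q \<le> \<Lambda> / 2^j" using Max_in[OF finj] unfolding j_def by blast+
      have "real (card (X P \<inter> X Q)) \<le> w j"
      proof (cases "j = l")
        case True
        have "K0 * 2 ^ (l * k) \<le> K * 2 ^ (l * k)"
          using K0(1) K2 L by (intro mult_right_mono) (auto simp: K_def)
        moreover have "w l = K * 2 ^ (l * k)" by (simp only: w_def lk power_add)
        ultimately have "real (card (X P \<inter> X Q)) \<le> w l" using b(1) by linarith
        thus ?thesis using True by simp
      next
        case False
        hence "Suc j \<le> l" using j by simp
        have gt: "\<Lambda> / 2 ^ Suc j < d P Q"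
        proof (rule ccontr)
          assume "\<not> ?thesis"
          hence "Suc j \<le> j" unfolding j_def using \<open>Suc j \<le> l\<close> by (intro Max_ge[OF finj]) (auto simp: j_def)
          thus False by simp
        qed
        have pos: "0 < \<Lambda> / 2 ^ Suc j" using L by simp
        have lt: "\<Lambda> / 2 ^ Suc j < K2 * affine_dist P Q" using gt d[OF PQ] by linarith
        hence "0 < K2 * affine_dist P Q" using pos by linarith
        hence ad: "0 < affine_dist P Q" using K2 by (simp add: zero_less_mult_iff)
        have "1 / affine_dist P Q \<le> 2 * K2 / \<Lambda> * 2 ^ j"
          using lt ad L K2 by (simp add: field_simps)
        hence "K0 * 2^(l * (k - 1)) * (1 / affine_dist P Q)
            \<le> K0 * 2^(l * (k - 1)) * (2 * K2 / \<Lambda> * 2 ^ j)"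
          using K0(1) by (intro mult_left_mono) auto
        also have "\<dots> = (2 * K0 * K2 / \<Lambda>) * (2^(l * (k - 1)) * 2 ^ j)" by simp
        also have "\<dots> \<le> w j" unfolding w_def K_def using K0(1) by (intro mult_right_mono) auto
        finally show ?thesis using b(2)[OF ad] by simp
      qed
      also have "w j = of_bool (d P Q \<le> \<Lambda> / 2^j) * w j" using j by simp
      also have "\<dots> \<le> (\<Sum>j\<le>l. of_bool (d P Q \<le> \<Lambda> / 2^j) * w j)"
        using j w0 by (intro member_le_sum) auto
      finally show ?thesis .
    qed
    have row: "(\<Sum>Q\<in>S. real (card (X P \<inter> X Q))) \<le> (real l + 1) * (K * 2 ^ (l * k))"
      if P: "P \<in> S" for P
    proof -
      have "(\<Sum>Q\<in>S. real (card (X P \<inter> X Q))) \<le> (\<Sum>Q\<in>S. \<Sum>j\<le>l. of_bool (d P Q \<le> \<Lambda> / 2^j) * w j)"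
        using pair[OF P] by (intro sum_mono)
      also have "\<dots> = (\<Sum>j\<le>l. (\<Sum>Q\<in>S. of_bool (d P Q \<le> \<Lambda> / 2^j)) * w j)"
        unfolding sum_distrib_right by (rule sum.swap)
      also have "\<dots> \<le> (\<Sum>j\<le>l. K * 2 ^ (l * k))"
      proof (rule sum_mono)
        fix j assume j: "j \<in> {..l}"
        have "(\<Sum>Q\<in>S. of_bool (d P Q \<le> \<Lambda> / 2^j)) = real (card {Q\<in>S. d P Q \<le> \<Lambda> / 2^j})"
          using fin by (simp add: Int_def)
        also have "\<dots> \<le> 2 powr (s * (real l - real j))" using frost[OF P] j by simp
        also have "\<dots> \<le> 2 powr (1 * (real l - real j))"
          using s j by (intro powr_mono mult_right_mono) auto
        also have "\<dots> = 2 ^ (l - j)" using j by (simp add: of_nat_diff flip: powr_realpow)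
        finally have "(\<Sum>Q\<in>S. of_bool (d P Q \<le> \<Lambda> / 2^j)) * w j \<le> 2 ^ (l - j) * w j"
          using w0 by (intro mult_right_mono)
        also have "\<dots> = K * (2 ^ (l * (k - 1)) * (2 ^ (l - j) * 2 ^ j))" by (simp add: w_def)
        also have "(2::real) ^ (l - j) * 2 ^ j = 2 ^ l" using j by (simp flip: power_add)
        also have "K * (2 ^ (l * (k - 1)) * 2 ^ l) = K * 2 ^ (l * k)" unfolding lk power_add ..
        finally show "(\<Sum>Q\<in>S. of_bool (d P Q \<le> \<Lambda> / 2^j)) * w j \<le> K * 2 ^ (l * k)" .
      qed
      finally show ?thesis by (simp add: algebra_simps)
    qed
    have "(real (card S) * T)\<^sup>2 \<le> (\<Sum>P\<in>S. real (card (X P)))\<^sup>2"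
    proof (rule power_mono)
      have "(\<Sum>P\<in>S. T) \<le> (\<Sum>P\<in>S. real (card (X P)))" using X by (intro sum_mono) blast
      thus "real (card S) * T \<le> (\<Sum>P\<in>S. real (card (X P)))" by simp
    qed (use T in auto)
    also have "\<dots> \<le> real (card C) * (\<Sum>P\<in>S. \<Sum>Q\<in>S. real (card (X P \<inter> X Q)))"
      using fin finC X by (intro sum_card_square_le) auto
    also have "\<dots> \<le> real (card C) * (\<Sum>P\<in>S. (real l + 1) * (K * 2 ^ (l * k)))"
      using row by (intro mult_left_mono sum_mono) auto
    finally have main: "real (card S) * (real (card S) * T\<^sup>2)
        \<le> real (card S) * (K * (real l + 1) * 2^(l * k) * real (card C))"
      by (simp add: power2_eq_square algebra_simps)
    show "real (card S) * T\<^sup>2 \<le> K * (real l + 1) * 2^(l * k) * real (card C)"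
    proof (cases "card S = 0")
      case True
      thus ?thesis using K by simp
    next
      case False
      thus ?thesis using main by (simp add: mult_le_cancel_left)
    qed
  qed
qed

text \<open>
  The margin \<open>8 e\<close> is spent as follows. The square of the threshold \<open>T l\<close> costs \<open>4 e\<close> and the factor
  \<open>l + 1\<close> from the \<open>L\<^sup>2\<close> bound costs \<open>e\<close>, so that \<open>card S\<close> is \<open>O(2\<^sup>(\<^sup>u\<^sup>-\<^sup>k\<^sup>+\<^sup>5\<^sup>e\<^sup>)\<^sup>l)\<close>. The factor \<open>l + 1\<close> from
  \<open>discrete_frostman\<close> costs another \<open>e\<close>. The remaining \<open>2 e\<close> make the contents of the sets \<open>F l\<close> decay
  geometrically.
\<close>

lemma hcontent_planes_zero:
  fixes E :: "(real ^ 'n) set set" and B :: "(real ^ 'n) set" and \<rho> :: "(real ^ 'n) set metric"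
  assumes E: "E \<subseteq> mspace \<rho>" "E \<subseteq> plane_chart J m" and J: "card J = k" "1 \<le> k" and m: "0 \<le> m"
    and K2: "0 < K2" "\<And>P Q. P \<in> E \<Longrightarrow> Q \<in> E \<Longrightarrow> mdist \<rho> P Q \<le> K2 * affine_dist P Q"
    and s: "0 < s" "s \<le> 1" and e: "0 < e" and u: "0 < u" "u \<le> s + real k - 8 * e"
    and c0: "0 < c0" "\<And>P. P \<in> E \<Longrightarrow> ennreal c0 \<le> hcontent dist (real k - e) (B \<inter> P \<inter> cball 0 m)"
    and z: "hcontent dist u B = 0"
  shows "hcontent (mdist \<rho>) s E = 0"
proof -
  define n where "n = real CARD('n)"
  define \<Lambda> where "\<Lambda> = K2 * ((2 * n\<^sup>2 + n + 2 * n^3 * m) * (2 * m)) + 1"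
  have L: "0 < \<Lambda>" using K2(1) m by (simp add: \<Lambda>_def n_def add_nonneg_pos)
  have diam: "mdist \<rho> P Q \<le> \<Lambda>" if PQ: "P \<in> E" "Q \<in> E" for P Q
  proof -
    obtain A b where Ab: "P = graph_plane J A b" "\<And>j. j \<in> J \<Longrightarrow> b $ j = 0"
      "\<And>i j. \<bar>A $ i $ j\<bar> \<le> m" "\<And>i. \<bar>b $ i\<bar> \<le> m"
      using subsetD[OF E(2) PQ(1)] unfolding plane_chart_def by blast
    obtain A' b' where Ab': "Q = graph_plane J A' b'" "\<And>j. j \<in> J \<Longrightarrow> b' $ j = 0"
      "\<And>i j. \<bar>A' $ i $ j\<bar> \<le> m" "\<And>i. \<bar>b' $ i\<bar> \<le> m"
      using subsetD[OF E(2) PQ(2)] unfolding plane_chart_def by blast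
    have "affine_dist P Q \<le> (2 * n\<^sup>2 + n + 2 * n^3 * m) * (2 * m)"
      unfolding Ab(1) Ab'(1) n_def
    proof (rule affine_dist_graph_plane_le)
      show "\<bar>A $ i $ j - A' $ i $ j\<bar> \<le> 2 * m" for i j
        using Ab(3)[of i j] Ab'(3)[of i j] by linarith
      show "\<bar>b $ i - b' $ i\<bar> \<le> 2 * m" for i
        using Ab(4)[of i] Ab'(4)[of i] by linarith
    qed (use Ab(2) Ab'(2,4) in auto)
    hence "K2 * affine_dist P Q \<le> \<Lambda>" unfolding \<Lambda>_def using K2(1) by (simp add: add_increasing2 mult_left_mono)
    thus ?thesis using K2(2)[OF PQ] by linarith
  qed
  obtain K where K: "K > 0"
    "\<And>l S d C X T. finite S \<Longrightarrow> S \<subseteq> plane_chart J m \<Longrightarrow>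
      (\<And>P Q. P \<in> S \<Longrightarrow> Q \<in> S \<Longrightarrow> d P Q \<le> \<Lambda> \<and> d P Q \<le> K2 * affine_dist P Q) \<Longrightarrow>
      (\<And>P j. P \<in> S \<Longrightarrow> j \<le> l \<Longrightarrow>
         real (card {Q\<in>S. d P Q \<le> \<Lambda> / 2^j}) \<le> 2 powr (s * (real l - real j))) \<Longrightarrow>
      finite C \<Longrightarrow>
      (\<And>P. P \<in> S \<Longrightarrow> X P \<subseteq> C \<and> inj_on (\<lambda>z. restrict z J) (X P) \<and>
         (\<forall>z\<in>X P. \<exists>x\<in>P \<inter> cball 0 m. cell l x = z) \<and> T \<le> real (card (X P))) \<Longrightarrow>
      0 \<le> T \<Longrightarrow>
      real (card S) * T\<^sup>2 \<le> K * (real l + 1) * 2^(l * k) * real (card C)"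
    by (rule card_planes_at_scale[OF J m m L K2(1) s(2)]) blast
  obtain ce where ce: "ce > 0" "\<And>l::nat. real l + 1 \<le> ce * 2 powr (e * real l)"
    using Suc_le_powr[OF e] by blast
  define a where "a = real k - e"
  define c where "c = (n * (1 + n * m)) powr a"
  define K5 where "K5 = K * ce * 3 ^ CARD('n) * 2 powr u"
  define K6 where "K6 = 2 * (6 * \<Lambda>) powr s * ce * K5"
  have K56: "0 \<le> K5" "0 \<le> K6" "0 \<le> c" using K ce by (auto simp: K5_def K6_def c_def)
  define q where "q = 2 powr (- e)"
  have q: "q < 1" using powr_less_mono[of "- e" 0 2] e by (simp add: q_def)
  have "hcontent (mdist \<rho>) s E \<le> 0 + ennreal \<epsilon>" if eps: "\<epsilon> > 0" for \<epsilon>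
  proof -
    have "0 < min c0 \<epsilon>" "0 \<le> c + K6" using c0 eps K56 by auto
    then obtain l0 :: nat where l0: "(c + K6) * 2 powr (- e * real l0) / (1 - q) < min c0 \<epsilon>"
      unfolding q_def using tail_small[OF e] by blast
    have mono: "c' * 2 powr (- e * real l0) / (1 - q) < min c0 \<epsilon>" if "c' \<le> c + K6" for c'
    proof -
      have "c' * 2 powr (- e * real l0) / (1 - q) \<le> (c + K6) * 2 powr (- e * real l0) / (1 - q)"
        using that q by (intro divide_right_mono mult_right_mono) auto
      thus ?thesis using l0 by linarith
    qed
    obtain C :: "nat \<Rightarrow> ('n \<Rightarrow> int) set" where C: "\<And>l. finite (C l)"
      "\<And>l. real (card (C l)) \<le> 3 ^ CARD('n) * 2 powr (u * (real l + 1))"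
      "\<And>x. x \<in> B \<Longrightarrow> \<exists>l\<ge>l0. cell l x \<in> C l"
      using dyadic_cell_cover[OF z u(1)] by blast
    define Y where "Y l P = {x \<in> B \<inter> P \<inter> cball 0 m. cell l x \<in> C l}" for l P
    define g where "g l x = restrict (cell l x) J" for l and x :: "real ^ 'n"
    define T where "T l = 2 powr ((real k - 2 * e) * real l)" for l :: nat
    define F where "F l = {P\<in>E. T l < real (card (g l ` Y l P))}" for l
    have finW: "finite (g l ` Y l P)" for l P
    proof (rule finite_subset)
      show "g l ` Y l P \<subseteq> (\<lambda>z. restrict z J) ` C l" by (auto simp: g_def Y_def)
    qed (use C(1) in auto)
    have EF: "E \<subseteq> (\<Union>l\<in>{l0..}. F l)"
    proof
      fix P assume P: "P \<in> E"
      show "P \<in> (\<Union>l\<in>{l0..}. F l)"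
      proof (rule ccontr)
        assume no: "P \<notin> (\<Union>l\<in>{l0..}. F l)"
        have "hcontent dist a (B \<inter> P \<inter> cball 0 m) \<le> ennreal (c * 2 powr (- e * real l0) / (1 - 2 powr (- e)))"
        proof (rule hcontent_levels_le[where Z = "\<lambda>l. Y l P"])
          show "B \<inter> P \<inter> cball 0 m \<subseteq> (\<Union>l\<in>{l0..}. Y l P)"
            using C(3) by (fastforce simp: Y_def)
          fix l assume l: "l \<ge> l0"
          have "real (card (g l ` Y l P)) \<le> T l" using no l P by (auto simp: F_def not_less)
          hence "hcontent dist a (Y l P) \<le> ennreal (c * (T l * 2 powr (- a * real l)))"
            unfolding c_def n_def g_def using finW[of l P] P E(2) m
            by (intro hcontent_slice_le[where P = P and J = J]) (auto simp: Y_def g_def)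
          also have "T l * 2 powr (- a * real l) = 2 powr (- e * real l)"
            unfolding T_def a_def by (simp add: algebra_simps flip: powr_add)
          finally show "hcontent dist a (Y l P) \<le> ennreal (c * 2 powr (- e * real l))" .
        qed (use e K56 in auto)
        also have "\<dots> < ennreal c0" using mono[of c] K56 c0(1) by (intro ennreal_lessI) (auto simp: q_def)
        also have "\<dots> \<le> hcontent dist a (B \<inter> P \<inter> cball 0 m)" using c0(2)[OF P] by (simp add: a_def)
        finally show False by simp
      qed
    qed
    have level: "hcontent (mdist \<rho>) s (F l) \<le> ennreal (K6 * 2 powr (- e * real l))" for l
    proof -
      have FE: "F l \<subseteq> E" by (auto simp: F_def)
      obtain S where S: "finite S" "S \<subseteq> F l"
        "\<And>x j. x \<in> F l \<Longrightarrow> j \<le> l \<Longrightarrow> real (card {y\<in>S. mdist \<rho> x y \<le> \<Lambda> / 2^j}) \<le> 2 powr (s * (real l - real j))"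
        "hcontent (mdist \<rho>) s (F l) \<le> ennreal (2 * (6 * \<Lambda>) powr s * (real l + 1) * (real (card S) * 2 powr (- s * real l)))"
      proof (rule discrete_frostman[of "F l" \<rho> \<Lambda> s l])
        show "F l \<subseteq> mspace \<rho>" using FE E(1) by blast
        show "mdist \<rho> x y \<le> \<Lambda>" if "x \<in> F l" "y \<in> F l" for x y using diam that FE by blast
      qed (use L s in auto)
      have SE: "S \<subseteq> E" using S(2) FE by blast
      \<comment> \<open>One cell of the slice is kept for each of its projections, so that distinct cells have
        distinct coordinates in \<open>J\<close>.\<close>
      define X where "X P = (\<lambda>w. cell l (inv_into (Y l P) (g l) w)) ` (g l ` Y l P)" for P
      have restr: "restrict (cell l (inv_into (Y l P) (g l) w)) J = w" if "w \<in> g l ` Y l P" for P w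
        using f_inv_into_f[OF that] by (simp add: g_def)
      have XY: "\<exists>x\<in>Y l P. cell l x = z" if "z \<in> X P" for P z
        using that inv_into_into unfolding X_def by (metis (no_types, lifting) imageE)
      have "real (card S) * (T l)\<^sup>2 \<le> K * (real l + 1) * 2^(l * k) * real (card (C l))"
      proof (rule K(2)[where X = X and d = "mdist \<rho>"])
        show "finite S" by fact
        show "S \<subseteq> plane_chart J m" using SE E(2) by blast
        show "mdist \<rho> P Q \<le> \<Lambda> \<and> mdist \<rho> P Q \<le> K2 * affine_dist P Q" if "P \<in> S" "Q \<in> S" for P Q
          using that diam K2(2) SE by blast
        show "real (card {Q\<in>S. mdist \<rho> P Q \<le> \<Lambda> / 2^j}) \<le> 2 powr (s * (real l - real j))"
          if "P \<in> S" "j \<le> l" for P j using S(2,3) that by blast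
        show "finite (C l)" by (rule C(1))
        show "0 \<le> T l" by (simp add: T_def)
        fix P assume P: "P \<in> S"
        have "inj_on (\<lambda>z. restrict z J) (X P)"
        proof (rule inj_onI)
          fix z z' assume "z \<in> X P" "z' \<in> X P" "restrict z J = restrict z' J"
          thus "z = z'" unfolding X_def using restr by fastforce
        qed
        moreover have "card (X P) = card (g l ` Y l P)"
          unfolding X_def by (rule card_image, rule inj_onI) (metis restr)
        moreover have "T l < real (card (g l ` Y l P))" using P S(2) by (auto simp: F_def)
        ultimately show "X P \<subseteq> C l \<and> inj_on (\<lambda>z. restrict z J) (X P) \<and>
            (\<forall>z\<in>X P. \<exists>x\<in>P \<inter> cball 0 m. cell l x = z) \<and> T l \<le> real (card (X P))"
          using XY by (fastforce simp: Y_def)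
      qed
      also have "\<dots> \<le> K * (ce * 2 powr (e * real l)) * 2^(l * k) * (3 ^ CARD('n) * 2 powr (u * (real l + 1)))"
        using K(1) ce C(2) by (intro mult_mono) auto
      also have "\<dots> = K5 * 2 powr (e * real l + real k * real l + u * real l)"
        by (simp add: K5_def powr_add algebra_simps flip: powr_realpow)
      also have "\<dots> = K5 * 2 powr ((u - real k + 5 * e) * real l) * (T l)\<^sup>2"
        unfolding T_def power2_eq_square mult.assoc
        by (simp add: algebra_simps flip: powr_add)
      finally have "real (card S) \<le> K5 * 2 powr ((u - real k + 5 * e) * real l)"
        by (simp add: T_def)
      also have "\<dots> \<le> K5 * 2 powr ((s - 3 * e) * real l)"
        using K56 u by (intro mult_left_mono powr_mono mult_right_mono) auto
      finally have cS: "real (card S) \<le> K5 * 2 powr ((s - 3 * e) * real l)" .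
      have "2 * (6 * \<Lambda>) powr s * (real l + 1) * (real (card S) * 2 powr (- s * real l))
          \<le> 2 * (6 * \<Lambda>) powr s * (ce * 2 powr (e * real l)) * (K5 * 2 powr ((s - 3 * e) * real l) * 2 powr (- s * real l))"
        using ce cS by (intro mult_mono mult_left_mono mult_right_mono) auto
      also have "\<dots> = K6 * (2 powr (e * real l) * (2 powr ((s - 3 * e) * real l) * 2 powr (- s * real l)))"
        by (simp add: K6_def)
      also have "2 powr (e * real l) * (2 powr ((s - 3 * e) * real l) * 2 powr (- s * real l)) = 2 powr (- 2 * e * real l)"
        unfolding powr_add[symmetric] by (simp add: algebra_simps)
      also have "K6 * 2 powr (- 2 * e * real l) \<le> K6 * 2 powr (- e * real l)"
        using K56 e by (intro mult_left_mono powr_mono) auto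
      finally show ?thesis using S(4) by (meson ennreal_leI order_trans)
    qed
    have "hcontent (mdist \<rho>) s E \<le> ennreal (K6 * 2 powr (- e * real l0) / (1 - 2 powr (- e)))"
      by (rule hcontent_levels_le[OF EF e K56(2) level])
    also have "\<dots> \<le> ennreal \<epsilon>" using mono[of K6] K56 by (intro ennreal_leI) (auto simp: q_def)
    finally show ?thesis by simp
  qed
  hence "hcontent (mdist \<rho>) s E \<le> 0" by (rule ennreal_le_epsilon)
  thus ?thesis by simp
qed

section \<open>Hausdorff dimension of unions of planes\<close>

lemma hausdorff_dim_Union_affine_subspaces_le:
  fixes E :: "(real ^ 'n) set set" and \<rho> :: "(real ^ 'n) set metric"
  assumes nat: "natural_metric k \<rho>" and E: "E \<subseteq> affine_subspaces k"
    and s: "0 \<le> s" "hausdorff_dim \<rho> E = ennreal s"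
  shows "hausdorff_dim euclidean_metric (\<Union>E) \<le> ennreal (s + real k)"
proof (rule ennreal_le_epsilon)
  fix e :: real assume e: "0 < e"
  obtain K1 where K1: "K1 > 0"
    "\<And>P P'. P \<in> affine_subspaces k \<Longrightarrow> P' \<in> affine_subspaces k \<Longrightarrow> K1 * affine_dist P P' \<le> mdist \<rho> P P'"
    using nat unfolding natural_metric_def by blast
  have t: "0 < s + e" using s e by simp
  have "hausdorff_dim \<rho> E < ennreal (s + e)" using s e by (simp add: ennreal_lessI)
  hence "hcontent (mdist \<rho>) (s + e) E = 0" using t by (rule hausdorff_dim_less_imp)
  hence "hcontent affine_dist (s + e) E = 0"
  proof (rule hcontent_zero_lipschitz[where K = "1 / K1"])
    fix P P' assume "P \<in> E" "P' \<in> E"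
    thus "affine_dist P P' \<le> 1 / K1 * mdist \<rho> P P'"
      using K1(2)[of P P'] K1(1) E by (auto simp: field_simps)
  qed (use K1 t in auto)
  hence "hcontent dist (s + e + real k) (\<Union>E) = 0" by (rule hcontent_Union_zero[OF E t])
  hence "hausdorff_dim euclidean_metric (\<Union>E) \<le> ennreal (s + e + real k)"
    using t by (intro hausdorff_dim_le) auto
  also have "\<dots> = ennreal (s + real k) + ennreal e" using s e by (simp flip: ennreal_plus add: algebra_simps)
  finally show "hausdorff_dim euclidean_metric (\<Union>E) \<le> ennreal (s + real k) + ennreal e" .
qed

text \<open>
  The set \<open>E\<close> is the countable union of the sets \<open>F J i\<close> of planes that lie in one chart and whose slice
  of \<open>B\<close> in a fixed ball has content bounded from below. The exponent \<open>s - e\<close> is still positive, and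
  \<open>e\<close> is small enough for \<open>u \<le> (s - e) + k - 8 e\<close>.
\<close>

lemma hausdorff_dim_ge_of_plane_slices:
  fixes E :: "(real ^ 'n) set set" and \<rho> :: "(real ^ 'n) set metric" and B :: "(real ^ 'n) set"
  assumes nat: "natural_metric k \<rho>" and E: "E \<subseteq> affine_subspaces k" and k: "1 \<le> k"
    and s: "0 < s" "s \<le> 1" "hausdorff_dim \<rho> E = ennreal s"
    and B: "\<And>P. P \<in> E \<Longrightarrow> hausdorff_dim euclidean_metric (B \<inter> P) = ennreal (real k)"
  shows "ennreal (s + real k) \<le> hausdorff_dim euclidean_metric B"
proof (rule ccontr)
  assume "\<not> ?thesis"
  hence "hausdorff_dim euclidean_metric B < ennreal (s + real k)" by simp
  then obtain u' where u': "hausdorff_dim euclidean_metric B < u'" "u' < ennreal (s + real k)"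
    using dense by blast
  define u where "u = enn2real u'"
  have uu: "u' = ennreal u" unfolding u_def using u'(2) by (metis ennreal_enn2real ennreal_less_top order.strict_trans)
  have "0 < u'" using u'(1) by (metis not_gr_zero not_less_zero)
  hence u0: "0 < u" unfolding uu by (simp add: ennreal_less_zero_iff)
  have us: "u < s + real k" using u'(2) u0 unfolding uu by (subst (asm) ennreal_less_iff) auto
  have zB: "hcontent dist u B = 0"
    using hausdorff_dim_less_imp[of euclidean_metric B u] u'(1) u0 unfolding uu by simp
  define e where "e = min (1/2) (min (s/2) ((s + real k - u) / 9))"
  have e: "0 < e" "e \<le> 1/2" "e \<le> s/2" "9 * e \<le> s + real k - u"
    using s(1) us unfolding e_def by (auto simp: min_def)
  obtain K2 where K2: "K2 > 0"
    "\<And>P P'. P \<in> affine_subspaces k \<Longrightarrow> P' \<in> affine_subspaces k \<Longrightarrow> mdist \<rho> P P' \<le> K2 * affine_dist P P'"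
    and ms: "mspace \<rho> = affine_subspaces k"
    using nat unfolding natural_metric_def by blast
  define F where "F J i = {P \<in> E \<inter> plane_chart J (real i).
      ennreal (1 / real (Suc i)) \<le> hcontent dist (real k - e) (B \<inter> P \<inter> cball 0 (real i))}" for J and i :: nat
  define I where "I = {(J :: 'n set, i :: nat). card J = k}"
  have EF: "E \<subseteq> (\<Union>(J, i)\<in>I. F J i)"
  proof
    fix P assume P: "P \<in> E"
    obtain J m where J: "card J = k" "P \<in> plane_chart J m"
      using affine_subspace_in_chart[of P k] E P by blast
    have "hcontent dist (real k - e) (B \<inter> P) \<noteq> 0"
    proof
      assume "hcontent dist (real k - e) (B \<inter> P) = 0"
      hence "hausdorff_dim euclidean_metric (B \<inter> P) \<le> ennreal (real k - e)"
        using e k by (intro hausdorff_dim_le) auto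
      also have "\<dots> < ennreal (real k)" using e k by (intro ennreal_lessI) auto
      finally show False using B[OF P] by simp
    qed
    moreover have "B \<inter> P = (\<Union>i. B \<inter> P \<inter> cball 0 (real i))"
      using real_arch_simple by auto
    ultimately obtain i1 where i1: "hcontent dist (real k - e) (B \<inter> P \<inter> cball 0 (real i1)) \<noteq> 0"
      using hcontent_UN_zero[of UNIV dist "real k - e" "\<lambda>i. B \<inter> P \<inter> cball 0 (real i)"] by auto
    obtain i2 :: nat where i2: "ennreal (1 / real (Suc i2)) < hcontent dist (real k - e) (B \<inter> P \<inter> cball 0 (real i1))"
    proof -
      obtain x where x: "0 < x" "x < hcontent dist (real k - e) (B \<inter> P \<inter> cball 0 (real i1))"
        using i1 dense not_gr_zero by blast
      define y where "y = enn2real x"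
      have y: "x = ennreal y" unfolding y_def using x(2) by (metis ennreal_enn2real top.extremum_strict less_top order.strict_trans2 top.not_eq_extremum)
      hence "0 < y" using x(1) by (simp add: ennreal_less_zero_iff)
      then obtain i2 where "inverse (real (Suc i2)) < y" using reals_Archimedean by blast
      hence "ennreal (1 / real (Suc i2)) < x" unfolding y using \<open>0 < y\<close> by (intro ennreal_lessI) (auto simp: inverse_eq_divide)
      thus ?thesis using that x(2) by (meson order.strict_trans)
    qed
    define i where "i = max (nat \<lceil>m\<rceil>) (max i1 i2)"
    have i: "m \<le> real i" "i1 \<le> i" "i2 \<le> i" unfolding i_def by linarith+
    have "ennreal (1 / real (Suc i)) \<le> ennreal (1 / real (Suc i2))"
      using i(3) by (intro ennreal_leI divide_left_mono) auto
    also have "\<dots> \<le> hcontent dist (real k - e) (B \<inter> P \<inter> cball 0 (real i1))" using i2 by simp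
    also have "\<dots> \<le> hcontent dist (real k - e) (B \<inter> P \<inter> cball 0 (real i))"
      using i(2) by (intro hcontent_mono) auto
    finally have "P \<in> F J i" using P J plane_chart_mono[OF i(1)] by (auto simp: F_def)
    thus "P \<in> (\<Union>(J, i)\<in>I. F J i)" using J(1) by (auto simp: I_def)
  qed
  have "hcontent (mdist \<rho>) (s - e) (\<Union>(J, i)\<in>I. F J i) = 0"
  proof (rule hcontent_UN_zero)
    fix p assume p: "p \<in> I"
    obtain J i where Ji: "p = (J, i)" by fastforce
    have "hcontent (mdist \<rho>) (s - e) (F J i) = 0"
    proof (rule hcontent_planes_zero[where m = "real i" and J = J and ?K2.0 = K2 and e = e and u = u and ?c0.0 = "1 / real (Suc i)"])
      show "F J i \<subseteq> mspace \<rho>" "F J i \<subseteq> plane_chart J (real i)" using E by (auto simp: F_def ms)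
      show "mdist \<rho> P Q \<le> K2 * affine_dist P Q" if "P \<in> F J i" "Q \<in> F J i" for P Q
        using that K2(2) E by (auto simp: F_def)
    qed (use p Ji k K2 e s u0 zB in \<open>auto simp: I_def F_def\<close>)
    thus "hcontent (mdist \<rho>) (s - e) (case p of (J, i) \<Rightarrow> F J i) = 0" by (simp add: Ji)
  qed (rule countableI_type)
  hence "hcontent (mdist \<rho>) (s - e) E = 0" using hcontent_mono[OF EF] by (metis le_zero_eq)
  hence "hausdorff_dim \<rho> E \<le> ennreal (s - e)" using e s E ms by (intro hausdorff_dim_le) auto
  also have "\<dots> < ennreal s" using e s by (intro ennreal_lessI) auto
  finally show False using s(3) by simp
qed

theorem theorem1p2:
  fixes k :: nat and s :: real
    and \<rho> :: "(real ^ 'n) set metric"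
    and E :: "(real ^ 'n) set set" and B :: "(real ^ 'n) set"
  assumes "1 \<le> k" and "k < CARD('n)"
    and "0 \<le> s" and "s \<le> 1"
    and "natural_metric k \<rho>"
    and "E \<subseteq> affine_subspaces k" and "E \<noteq> {}"
    and "hausdorff_dim \<rho> E = ennreal s"
    and "B \<subseteq> \<Union>E"
    and "\<forall>P\<in>E. hausdorff_dim euclidean_metric (B \<inter> P) = ennreal (real k)"
  shows "hausdorff_dim euclidean_metric B = hausdorff_dim euclidean_metric (\<Union>E) \<and>
    hausdorff_dim euclidean_metric (\<Union>E) = ennreal (s + real k)"
proof -
  have upper: "hausdorff_dim euclidean_metric (\<Union>E) \<le> ennreal (s + real k)"
    using assms by (intro hausdorff_dim_Union_affine_subspaces_le)
  have mono: "hausdorff_dim euclidean_metric B \<le> hausdorff_dim euclidean_metric (\<Union>E)"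
    using assms by (intro hausdorff_dim_mono)
  have "ennreal (s + real k) \<le> hausdorff_dim euclidean_metric B"
  proof (cases "s = 0")
    case True
    obtain P where P: "P \<in> E" using assms by blast
    have "hausdorff_dim euclidean_metric (B \<inter> P) \<le> hausdorff_dim euclidean_metric B"
      by (rule hausdorff_dim_mono) auto
    thus ?thesis using assms P True by simp
  next
    case False
    thus ?thesis using assms by (intro hausdorff_dim_ge_of_plane_slices[where E = E and \<rho> = \<rho>]) auto
  qed
  thus ?thesis using upper mono by (meson order_antisym order_trans)
qed

end
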